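(* Given integers $x,y$ and $m$, let $z=\max(y^2,\omega(m))$. Suppose that $$\log\log x\le y\le\frac{\log x}{3\log\log x}\qquad\text{and}\qquad y^2\le z\le x^{\frac{2}{3y}}.$$ Then $$\sum_{\substack{n\le x,\ \omega(n)=y\\ (n,m)=1,\ n \text{ squarefree}}}1\ \ge\ \frac{x}{\log x}\,\frac{L^{\,y+O(y/L)}}{y!},\qquad\text{where } L=\log\left(\frac{\log x}{y\log\sqrt z}\right).$$
   Context: $\omega(n)$ denotes the number of distinct prime factors of $n$. The sum is over squarefree positive integers $n\le x$ coprime to $m$ with exactly $y$ prime factors. The implied constant in the exponent $O(y/L)$ is absolute.
   Formalization: Formalized with x ≥ 7 and m nonzero: as printed the claim fails for tiny x (x=3, y=1, m=6: the sum is 0 but the right side is positive); only x in {3,4,5,6} with y=1 is excluded, and ω(0) is undefined. *)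

theory Defs
  imports
    Complex_Main
    "HOL-Computational_Algebra.Primes"
    "HOL-Computational_Algebra.Squarefree"
begin

definition omega :: "int \<Rightarrow> nat"
  where "omega n = card (prime_factors n)"

end

theory Submission
  imports Defs "HOL-Number_Theory.Prime_Powers" "HOL-Analysis.Harmonic_Numbers"
begin

text \<open>
  Let \<open>W = x powr (1/y)\<close>. Take a set \<open>T\<close> of \<open>y - 1\<close> primes not dividing \<open>m\<close> and lying in an interval
  \<open>(M, W]\<close> with \<open>M\<close> about \<open>z powr (5/4)\<close>. Then \<open>x / \<Prod>T \<ge> W\<close>, and since \<open>z\<close> is at most
  \<open>W powr (2/3)\<close>, Chebyshev's bound supplies at least a constant times \<open>x / (\<Prod>T * ln x)\<close> primes
  \<open>p \<le> x / \<Prod>T\<close> that neither divide \<open>m\<close> nor belong to \<open>T\<close>. Each \<open>n = p * \<Prod>T\<close> is obtained at most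
  \<open>y\<close> times, so the count is at least \<open>x / (20 * y * ln x)\<close> times the elementary symmetric sum of
  degree \<open>y - 1\<close> in the reciprocals of these primes, which is essentially \<open>S ^ (y - 1) / (y - 1)!\<close>
  for the sum \<open>S\<close> of the reciprocals. By Mertens' theorem \<open>S \<ge> L - ln (29/10)\<close> once \<open>z\<close> is large; the
  loss is a constant smaller than \<open>ln 3 \<le> L\<close>, hence is absorbed by the factor \<open>L powr O(1/L)\<close>. When \<open>z\<close>
  is bounded, \<open>y\<close> and \<open>x\<close> are bounded too, and it suffices that the count is nonzero.
\<close>

section \<open>Chebyshev and Mertens estimates\<close>

text \<open>Passing from \<open>n\<close> to \<open>Suc n\<close> raises \<open>n div d\<close> by
  one exactly when \<open>d\<close> divides \<open>Suc n\<close>, and the Mangoldt values over those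
  divisors add up to \<open>ln (Suc n)\<close>.\<close>

lemma ln_fact_eq_sum_mangoldt:
  "ln (fact n :: real) = (\<Sum>d=1..n. mangoldt d * real (n div d))"
proof (induction n)
  case (Suc n)
  have "(\<Sum>d=1..Suc n. mangoldt d * real (Suc n div d))
      = (\<Sum>d=1..Suc n. mangoldt d * real (n div d) + (if d dvd Suc n then mangoldt d else 0))"
    by (intro sum.cong refl) (auto simp: dvd_eq_mod_eq_0 div_Suc algebra_simps)
  also have "\<dots> = (\<Sum>d=1..Suc n. mangoldt d * real (n div d))
      + (\<Sum>d\<in>{1..Suc n}. if d dvd Suc n then mangoldt d else 0)"
    by (rule sum.distrib)
  also have "(\<Sum>d=1..Suc n. mangoldt d * real (n div d)) = ln (fact n)"
    using Suc by simp
  also have "(\<Sum>d\<in>{1..Suc n}. if d dvd Suc n then mangoldt d else 0)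
      = (\<Sum>d | d dvd Suc n. mangoldt d :: real)"
    by (subst sum.inter_filter [symmetric], simp, intro sum.cong)
       (auto dest: dvd_imp_le simp: Suc_le_eq intro!: Nat.gr0I)
  also have "\<dots> = ln (real (Suc n))"
    by (subst mangoldt_sum) simp_all
  also have "ln (fact n) + ln (real (Suc n)) = ln (fact (Suc n) :: real)"
    by (simp add: ln_mult add.commute)
  finally show ?case ..
qed simp

section \<open>Chebyshev's function and its bounds from central binomial coefficients\<close>

definition psi :: "nat \<Rightarrow> real" where "psi n = (\<Sum>d=1..n. mangoldt d)"

lemma ln_central_binomial:
  "ln (real ((2 * n) choose n))
    = (\<Sum>d=1..2*n. mangoldt d * (real (2 * n div d) - 2 * real (n div d)))"
proof -
  have "real ((2 * n) choose n) = fact (2 * n) / (fact n * fact n)"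
    using binomial_fact[of n "2 * n", where ?'a = real] by simp
  hence "ln (real ((2 * n) choose n)) = ln (fact (2 * n)) - 2 * ln (fact n)"
    by (simp add: ln_div ln_mult)
  \<comment> \<open>The terms with \<open>d > n\<close> vanish, so both factorials can be expanded
    over the same range.\<close>
  also have "ln (fact n :: real) = (\<Sum>d=1..2*n. mangoldt d * real (n div d))"
    unfolding ln_fact_eq_sum_mangoldt by (rule sum.mono_neutral_left) auto
  finally show ?thesis
    unfolding ln_fact_eq_sum_mangoldt
    by (simp add: sum_subtractf right_diff_distrib sum_distrib_left mult_ac)
qed

text \<open>Hence the coefficients in the expansion of the central binomial coefficient are all 0 or
  1.\<close>

lemma div_double_bounds:
  fixes n d :: nat
  assumes "d > 0"
  shows "2 * (n div d) \<le> 2 * n div d" "2 * n div d \<le> 2 * (n div d) + 1"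
proof -
  show "2 * (n div d) \<le> 2 * n div d"
    using assms div_times_less_eq_dividend[of n d] by (simp add: less_eq_div_iff_mult_less_eq)
  have "n < d * (n div d + 1)"
    using assms by (metis dividend_less_times_div Suc_eq_plus1 mult_Suc_right add.commute)
  hence "2 * n < (2 * (n div d) + 2) * d" by (simp add: algebra_simps)
  hence "2 * n div d < 2 * (n div d) + 2"
    using assms by (simp add: div_less_iff_less_mult)
  thus "2 * n div d \<le> 2 * (n div d) + 1" by simp
qed

text \<open>All coefficients are at most 1, so \<open>psi (2 * n)\<close> dominates the logarithm of
  the central binomial coefficient, which is at least \<open>4 ^ n / (2 * n)\<close>.\<close>

lemma psi_double_ge: "n > 0 \<Longrightarrow> psi (2 * n) \<ge> real n * ln 4 - ln (2 * real n)"
proof -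
  assume n: "n > 0"
  have "4 ^ n / (2 * real n) \<le> real ((2 * n) choose n)"
    using central_binomial_lower_bound[OF n] by simp
  hence "ln (4 ^ n / (2 * real n)) \<le> ln (real ((2 * n) choose n))"
    using n by (subst ln_le_cancel_iff) auto
  also have "\<dots> \<le> psi (2 * n)"
    unfolding ln_central_binomial psi_def
  proof (intro sum_mono)
    fix d assume "d \<in> {1..2*n}"
    hence "2 * n div d \<le> 2 * (n div d) + 1"
      using div_double_bounds(2)[of d n] by simp
    hence "real (2 * n div d) - 2 * real (n div d) \<le> 1"
      by linarith
    thus "mangoldt d * (real (2 * n div d) - 2 * real (n div d)) \<le> mangoldt d"
      using mangoldt_nonneg[of d] by (simp add: mult_left_le)
  qed
  finally show ?thesis using n by (simp add: ln_div ln_realpow)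
qed

text \<open>Every \<open>d\<close> in the upper half of the range has coefficient at least 1 and no
  coefficient is negative, so the block from \<open>n + 1\<close> to \<open>2 * n\<close> costs at
  most the logarithm of a binomial coefficient below \<open>4 ^ n\<close>.\<close>

lemma psi_double_le: "psi (2 * n) \<le> psi n + real n * ln 4"
proof -
  have "psi (2 * n) - psi n = (\<Sum>d=n+1..2*n. mangoldt d)"
    unfolding psi_def by (subst sum_diff [symmetric]) (auto intro!: sum.cong)
  also have "\<dots> \<le> (\<Sum>d=n+1..2*n. mangoldt d * (real (2 * n div d) - 2 * real (n div d)))"
  proof (intro sum_mono)
    fix d assume d: "d \<in> {n+1..2*n}"
    hence "2 * n div d \<ge> 1" "n div d = 0" by (auto simp: div_greater_zero_iff Suc_le_eq)
    hence "real (2 * n div d) - 2 * real (n div d) \<ge> 1" by simp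
    thus "mangoldt d \<le> mangoldt d * (real (2 * n div d) - 2 * real (n div d))"
      using mangoldt_nonneg[of d] by (simp add: mult_left_le mult_le_cancel_left1)
  qed
  also have "\<dots> \<le> (\<Sum>d=1..2*n. mangoldt d * (real (2 * n div d) - 2 * real (n div d)))"
  proof (rule sum_mono2)
    fix d assume "d \<in> {1..2*n} - {n+1..2*n}"
    hence "2 * (n div d) \<le> 2 * n div d"
      using div_double_bounds(1)[of d n] by simp
    hence "real (2 * n div d) - 2 * real (n div d) \<ge> 0"
      by linarith
    thus "mangoldt d * (real (2 * n div d) - 2 * real (n div d)) \<ge> 0"
      using mangoldt_nonneg[of d] by simp
  qed auto
  also have "\<dots> = ln (real ((2 * n) choose n))" by (rule ln_central_binomial [symmetric])
  also have "\<dots> \<le> ln (2 ^ (2 * n))"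
    using binomial_le_pow2[of "2 * n" n] zero_less_binomial[of n "2 * n"]
    by (subst ln_le_cancel_iff)
       (simp_all del: zero_less_binomial_iff add: of_nat_le_iff[of _ "2 ^ (2 * n)", where ?'a = real, simplified])
  also have "\<dots> = real n * ln 4" by (simp add: ln_realpow power_mult)
  finally show ?thesis by simp
qed

text \<open>Induction by halving. The constant 4 is generous: it also pays for the extra term
  \<open>mangoldt n\<close>, at most \<open>n - 1\<close>, when \<open>n\<close> is odd.\<close>

lemma psi_le: "psi n \<le> 4 * real n"
proof (induction n rule: less_induct)
  case (less n)
  have ln4: "ln 4 \<le> (3/2 :: real)"
    using ln_2_less_1 ln_realpow[of 2 2] ln2_le_25_over_36 by simp
  show ?case
  proof (cases "n = 0")
    case False
    define k where "k = n div 2"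
    have k: "k < n" using False by (simp add: k_def)
    have "psi (2 * k) \<le> 4 * real k + real k * (3/2)"
      using psi_double_le[of k] less[OF k] mult_left_mono[OF ln4, of "real k"] by linarith
    show ?thesis
    proof (cases "even n")
      case True
      hence "n = 2 * k" by (simp add: k_def)
      thus ?thesis using \<open>psi (2 * k) \<le> _\<close> by simp
    next
      case False
      hence n: "n = Suc (2 * k)" by (simp add: k_def odd_two_times_div_two_succ)
      have "psi n = psi (2 * k) + mangoldt n" by (simp add: n psi_def)
      also have "mangoldt n \<le> ln (real n)" using mangoldt_le[of n] n by simp
      also have "ln (real n) \<le> real n - 1" using n by (intro ln_le_minus_one) simp
      finally show ?thesis using \<open>psi (2 * k) \<le> _\<close> by (simp add: n)
    qed
  qed (simp add: psi_def)
qed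

section \<open>Crude Stirling bounds and the weighted Mangoldt sum\<close>

lemma ln_fact_bounds:
  assumes "n > 0"
  shows "ln (fact n :: real) \<le> real n * ln (real n)"
    and "real n * ln (real n) - real n \<le> ln (fact n :: real)"
proof -
  have "ln (fact n :: real) \<le> ln (real n ^ n)"
    using fact_le_power[of n] assms by (subst ln_le_cancel_iff) auto
  thus "ln (fact n :: real) \<le> real n * ln (real n)" using assms by (simp add: ln_realpow)
  \<comment> \<open>A single term of the exponential series is at most its sum.\<close>
  have "real n ^ n / fact n \<le> exp (real n)"
    using sum_le_suminf[OF summable_exp_generic[of "real n"], of "{n}"]
    by (simp add: exp_def divide_inverse mult.commute)
  hence "ln (real n ^ n / fact n) \<le> ln (exp (real n))"
    using assms by (subst ln_le_cancel_iff) auto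
  thus "real n * ln (real n) - real n \<le> ln (fact n :: real)"
    using assms by (simp add: ln_div ln_realpow)
qed

text \<open>Replace \<open>n div d\<close> by \<open>n / d\<close> in the expansion of
  \<open>ln (fact n)\<close>. The lower bound loses 1 through Stirling; in the upper bound the
  rounding costs at most \<open>psi n\<close>, whence the 4.\<close>

lemma sum_mangoldt_over_bounds:
  assumes "n > 0"
  shows "(\<Sum>d=1..n. mangoldt d / real d) \<ge> ln (real n) - 1"
    and "(\<Sum>d=1..n. mangoldt d / real d) \<le> ln (real n) + 4"
proof -
  let ?S = "\<Sum>d=1..n. mangoldt d / real d"
  have "ln (fact n :: real) \<le> (\<Sum>d=1..n. mangoldt d * (real n / real d))"
    unfolding ln_fact_eq_sum_mangoldt
    by (intro sum_mono mult_left_mono mangoldt_nonneg of_nat_div_le_of_nat)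
  also have "\<dots> = real n * ?S" by (simp add: sum_distrib_left mult_ac)
  finally have "real n * (ln (real n) - 1) \<le> real n * ?S"
    using ln_fact_bounds(2)[OF assms] by (simp add: algebra_simps)
  thus "?S \<ge> ln (real n) - 1" using assms by simp
  have "real n * ?S - psi n = (\<Sum>d=1..n. mangoldt d * (real n / real d - 1))"
    by (simp add: psi_def sum_distrib_left sum_subtractf right_diff_distrib mult_ac)
  also have "\<dots> \<le> ln (fact n)"
    unfolding ln_fact_eq_sum_mangoldt
  proof (intro sum_mono mult_left_mono mangoldt_nonneg)
    fix d show "real n / real d - 1 \<le> real (n div d)"
      using real_of_int_div3[of "int n" "int d"] by (simp flip: zdiv_int)
  qed
  finally have "real n * ?S \<le> real n * (ln (real n) + 4)"
    using ln_fact_bounds(1)[OF assms] psi_le[of n] by (simp add: algebra_simps)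
  thus "?S \<le> ln (real n) + 4" using assms by simp
qed

section \<open>From prime powers to primes\<close>

lemma finite_powers_le:
  fixes p n :: nat
  assumes "p > 1"
  shows "finite {k. p ^ Suc k \<le> n}"
proof (rule finite_subset)
  have "k < p ^ Suc k" for k
    using less_exp[of "Suc k"] power_mono[of 2 p "Suc k"] assms by linarith
  thus "{k. p ^ Suc k \<le> n} \<subseteq> {..n}" by (auto intro: less_imp_le order.trans)
qed simp

text \<open>Only prime powers carry Mangoldt weight. Exponents are written \<open>Suc k\<close> so
  that each prime power comes from exactly one pair \<open>(p, k)\<close>.\<close>

lemma sum_mangoldt_by_primes:
  fixes f :: "nat \<Rightarrow> real"
  shows "(\<Sum>d=1..n. mangoldt d * f d)
    = (\<Sum>p | prime p \<and> p \<le> n. \<Sum>k | p ^ Suc k \<le> n. ln (real p) * f (p ^ Suc k))"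
proof -
  have fin: "finite {k. p ^ Suc k \<le> n}" if "prime p" for p :: nat
    using prime_gt_1_nat[OF that] by (rule finite_powers_le)
  have bij: "bij_betw (\<lambda>(p,k). p ^ Suc k)
               (SIGMA p:{p. prime p \<and> p \<le> n}. {k. p ^ Suc k \<le> n}) {d\<in>{1..n}. primepow d}"
  proof (rule bij_betw_subset[OF bij_betw_primepows], safe)
    fix p k :: nat assume "prime p" "p ^ Suc k \<le> n"
    thus "p ^ Suc k \<in> {1..n}" "primepow (p ^ Suc k)"
      by (auto simp: Suc_le_eq prime_gt_0_nat simp del: power_Suc)
  next
    fix d :: nat assume d: "d \<in> {1..n}" "primepow d"
    obtain p j where pj: "prime p" "j > 0" "d = p ^ j" using d(2) unfolding primepow_def by blast
    then obtain k where pk: "prime p" "d = p ^ Suc k" by (metis gr0_conv_Suc)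
    moreover have "p \<le> p ^ Suc k" using pk(1) by (intro self_le_power) (auto simp: Suc_le_eq prime_gt_0_nat)
    ultimately have "(p, k) \<in> (SIGMA p:{p. prime p \<and> p \<le> n}. {k. p ^ Suc k \<le> n})"
      using d(1) by (auto simp del: power_Suc)
    moreover have "d = (\<lambda>(p, k). p ^ Suc k) (p, k)" using pk by simp
    ultimately show "d \<in> (\<lambda>(p, k). p ^ Suc k) ` (SIGMA p:{p. prime p \<and> p \<le> n}. {k. p ^ Suc k \<le> n})"
      by (rule rev_image_eqI)
  qed auto
  have "(\<Sum>d=1..n. mangoldt d * f d) = (\<Sum>d\<in>{d\<in>{1..n}. primepow d}. mangoldt d * f d)"
    by (rule sum.mono_neutral_right) (auto simp: mangoldt_def)
  also have "\<dots> = (\<Sum>(p,k)\<in>(SIGMA p:{p. prime p \<and> p \<le> n}. {k. p ^ Suc k \<le> n}).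
                     mangoldt (p ^ Suc k) * f (p ^ Suc k))"
    by (subst sum.reindex_bij_betw[OF bij, symmetric]) (simp add: case_prod_unfold)
  also have "\<dots> = (\<Sum>p | prime p \<and> p \<le> n. \<Sum>k | p ^ Suc k \<le> n. mangoldt (p ^ Suc k) * f (p ^ Suc k))"
    by (rule sum.Sigma [symmetric]) (auto simp: fin simp del: power_Suc)
  also have "\<dots> = (\<Sum>p | prime p \<and> p \<le> n. \<Sum>k | p ^ Suc k \<le> n. ln (real p) * f (p ^ Suc k))"
    by (intro sum.cong refl) (simp del: power_Suc)
  finally show ?thesis .
qed

text \<open>A prime \<open>p\<close> contributes \<open>ln p\<close> once for each of its powers up
  to \<open>n\<close>, and there are at most \<open>ln n / ln p\<close> of them.\<close>

lemma psi_le_prime_count: "psi n \<le> real (card {p. prime p \<and> p \<le> n}) * ln (real n)"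
proof -
  have "psi n = (\<Sum>p | prime p \<and> p \<le> n. \<Sum>k | p ^ Suc k \<le> n. ln (real p))"
    using sum_mangoldt_by_primes[of "\<lambda>_. 1" n] by (simp add: psi_def)
  also have "\<dots> \<le> (\<Sum>p | prime p \<and> p \<le> n. ln (real n))"
  proof (intro sum_mono)
    fix p assume "p \<in> {p. prime p \<and> p \<le> n}"
    hence p: "prime p" "p \<le> n" "p > 1" by (auto simp: prime_gt_Suc_0_nat)
    define m where "m = nat \<lfloor>ln (real n) / ln (real p)\<rfloor>"
    have lnp: "ln (real p) > 0" using p by simp
    have quot: "ln (real n) / ln (real p) \<ge> 0" using p by simp
    have "{k. p ^ Suc k \<le> n} \<subseteq> {..<m}"
    proof safe
      fix k assume "p ^ Suc k \<le> n"
      hence "real p ^ Suc k \<le> real n" by (metis of_nat_le_iff of_nat_power)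
      hence "ln (real p ^ Suc k) \<le> ln (real n)" using p by (subst ln_le_cancel_iff) auto
      hence "real (Suc k) * ln (real p) \<le> ln (real n)"
        using p by (subst (asm) ln_realpow) auto
      hence "real (Suc k) \<le> ln (real n) / ln (real p)" using lnp by (simp add: le_divide_eq)
      thus "k < m" unfolding m_def by linarith
    qed
    hence "card {k. p ^ Suc k \<le> n} \<le> m" using card_mono[of "{..<m}"] by fastforce
    hence "real (card {k. p ^ Suc k \<le> n}) \<le> ln (real n) / ln (real p)"
      unfolding m_def using quot by linarith
    thus "(\<Sum>k | p ^ Suc k \<le> n. ln (real p)) \<le> ln (real n)"
      using lnp by (simp add: le_divide_eq del: power_Suc)
  qed
  finally show ?thesis by simp
qed

text \<open>Each term is dominated by a difference of consecutive values of \<open>4 / sqrt\<close>,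
  so the sum telescopes. It bounds the share of proper prime powers in the Mangoldt sum.\<close>

lemma sum_ln_over_square_le:
  "(\<Sum>k=2..n. ln (real k) / (real k * (real k - 1))) \<le> 4"
proof -
  have step_bound: "ln (real k) / (real k * (real k - 1)) \<le> 4 * (1 / sqrt (real k - 1) - 1 / sqrt (real k))"
    if "k \<ge> 2" for k :: nat
  proof -
    define a b where "a = sqrt (real k)" and "b = sqrt (real k - 1)"
    have ab: "b > 0" "a > 1" "a\<^sup>2 = real k" "b\<^sup>2 = real k - 1" "b < a"
      using that by (auto simp: a_def b_def)
    have "ln (real k) = 2 * ln a" using ab(2) by (simp add: ab(3)[symmetric] ln_realpow)
    also have "\<dots> \<le> 2 * (a - 1)" using ab ln_le_minus_one[of a] by simp
    also have "a - 1 \<le> b"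
    proof (rule power2_le_imp_le)
      have "(a - 1)\<^sup>2 = b\<^sup>2 - 2 * (a - 1)" using ab(3,4) by (simp add: power2_eq_square algebra_simps)
      thus "(a - 1)\<^sup>2 \<le> b\<^sup>2" using ab by simp
    qed (use ab in auto)
    finally have "ln (real k) / (real k * (real k - 1)) \<le> 2 * b / (a\<^sup>2 * b\<^sup>2)"
      using ab that by (simp add: divide_right_mono)
    also have "\<dots> = 2 / (a\<^sup>2 * b)" using ab(1,2) by (simp add: power2_eq_square)
    \<comment> \<open>The inserted factor \<open>a\<^sup>2 - b\<^sup>2\<close> equals 1 and brings
      out the difference \<open>a - b\<close> needed for telescoping.\<close>
    also have "\<dots> = 2 * (a\<^sup>2 - b\<^sup>2) / (a\<^sup>2 * b)" using ab(3,4) by simp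
    also have "\<dots> = 2 * (a - b) * (a + b) / (a\<^sup>2 * b)" by (simp add: power2_eq_square algebra_simps)
    also have "\<dots> \<le> 2 * (a - b) * (2 * a) / (a\<^sup>2 * b)"
      using ab by (intro divide_right_mono mult_left_mono) auto
    also have "\<dots> = 4 * (1 / b - 1 / a)" using ab(1,2) by (simp add: field_simps power2_eq_square)
    finally show ?thesis by (simp add: a_def b_def)
  qed
  have "n \<ge> 1 \<Longrightarrow> (\<Sum>k=2..n. ln (real k) / (real k * (real k - 1))) \<le> 4 * (1 - 1 / sqrt (real n))"
  proof (induction n rule: dec_induct)
    case (step m)
    show ?case using step.IH step_bound[of "Suc m"] step.hyps by simp
  qed simp
  thus ?thesis by (cases "n \<ge> 1") (force intro: order.trans)+
qed

text \<open>Primes alone give no more than the full Mangoldt sum. The higher powers form geometric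
  series worth at most 4 in total, which with the earlier loss of 1 gives 5.\<close>

lemma mertens_first:
  assumes "n > 0"
  shows "\<bar>(\<Sum>p | prime p \<and> p \<le> n. ln (real p) / real p) - ln (real n)\<bar> \<le> 5"
proof -
  let ?A = "\<Sum>p | prime p \<and> p \<le> n. ln (real p) / real p"
  let ?S = "\<Sum>d=1..n. mangoldt d / real d"
  have "?A = (\<Sum>p | prime p \<and> p \<le> n. mangoldt p / real p)" by (intro sum.cong) auto
  also have "\<dots> \<le> ?S"
    by (rule sum_mono2) (auto simp: mangoldt_nonneg Suc_le_eq prime_gt_0_nat)
  finally have upper: "?A \<le> ln (real n) + 4"
    using sum_mangoldt_over_bounds(2)[OF assms] by linarith
  have "?S = (\<Sum>p | prime p \<and> p \<le> n. \<Sum>k | p ^ Suc k \<le> n. ln (real p) * (1 / real (p ^ Suc k)))"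
    using sum_mangoldt_by_primes[of "\<lambda>d. 1 / real d" n] by simp
  also have "\<dots> \<le> (\<Sum>p | prime p \<and> p \<le> n. ln (real p) / real p + ln (real p) / (real p * (real p - 1)))"
  proof (intro sum_mono)
    fix p assume "p \<in> {p. prime p \<and> p \<le> n}"
    hence p: "p > 1" by (auto simp: prime_gt_Suc_0_nat)
    have geo: "(\<lambda>k. (1 / real p) ^ k) sums (1 / (1 - 1 / real p))"
      using p by (intro geometric_sums) auto
    have geo': "(\<lambda>k. 1 / real (p ^ Suc k)) sums (1 / real p * (1 / (1 - 1 / real p)))"
      using sums_mult[OF geo, of "1 / real p"] by (simp add: power_one_over)
    have fin: "finite {k. p ^ Suc k \<le> n}" using p by (rule finite_powers_le)
    have "(\<Sum>k | p ^ Suc k \<le> n. 1 / real (p ^ Suc k)) \<le> (\<Sum>k. 1 / real (p ^ Suc k))"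
      using geo' fin by (intro sum_le_suminf) (auto simp: sums_iff)
    also have "\<dots> = 1 / real p * (1 / (1 - 1 / real p))" using geo' by (rule sums_unique [symmetric])
    also have "\<dots> = 1 / real p + 1 / (real p * (real p - 1))" using p by (simp add: field_simps)
    finally have "ln (real p) * (\<Sum>k | p ^ Suc k \<le> n. 1 / real (p ^ Suc k))
        \<le> ln (real p) * (1 / real p + 1 / (real p * (real p - 1)))"
      using p by (intro mult_left_mono) auto
    thus "(\<Sum>k | p ^ Suc k \<le> n. ln (real p) * (1 / real (p ^ Suc k)))
        \<le> ln (real p) / real p + ln (real p) / (real p * (real p - 1))"
      by (simp add: sum_distrib_left distrib_left del: power_Suc)
  qed
  also have "\<dots> = ?A + (\<Sum>p | prime p \<and> p \<le> n. ln (real p) / (real p * (real p - 1)))"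
    by (rule sum.distrib)
  also have "(\<Sum>p | prime p \<and> p \<le> n. ln (real p) / (real p * (real p - 1)))
      \<le> (\<Sum>k=2..n. ln (real k) / (real k * (real k - 1)))"
    by (rule sum_mono2) (auto simp: prime_ge_2_nat)
  also have "\<dots> \<le> 4" by (rule sum_ln_over_square_le)
  finally have "?A \<ge> ln (real n) - 5"
    using sum_mangoldt_over_bounds(1)[OF assms] by linarith
  with upper show ?thesis by linarith
qed

text \<open>Partial summation, carried out as an induction on the upper end point: each step
  \<open>N \<rightarrow> N + 1\<close> loses a multiple of \<open>1 / ln N - 1 / ln (N + 1)\<close>, which telescopes.\<close>
lemma mertens_second_lower:
  assumes "2 \<le> M" "M \<le> N"
  shows "(\<Sum>p | prime p \<and> M < p \<and> p \<le> N. 1 / real p)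
    \<ge> ln (ln (real N)) - ln (ln (real M)) - 11 / ln (real M)"
proof -
  define A where "A n = (\<Sum>p | prime p \<and> p \<le> n. ln (real p) / real p)" for n :: nat
  define r where "r n = A n - ln (real n)" for n :: nat
  define T where "T N = (\<Sum>p | prime p \<and> M < p \<and> p \<le> N. 1 / real p)" for N
  have r: "\<bar>r n\<bar> \<le> 5" if "n \<ge> 2" for n using mertens_first[of n] that by (simp add: r_def A_def)
  \<comment> \<open>Summation by parts leaves the boundary terms \<open>r N / ln N\<close> and
    \<open>r M / ln M\<close>. The 6 consists of 5 for the bound on \<open>r\<close> and 1 for
    replacing increments of \<open>ln ln\<close> by \<open>(b - a) / b\<close>.\<close>
  have main: "T N - r N / ln (real N) \<ge> ln (ln (real N)) - ln (ln (real M))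
      - 6 * (1 / ln (real M) - 1 / ln (real N)) - r M / ln (real M)"
    using assms(2)
  proof (induction N rule: dec_induct)
    case base
    have "T M = 0" unfolding T_def by (rule sum.neutral) auto
    thus ?case by simp
  next
    case (step n)
    define a b where "a = ln (real n)" and "b = ln (real (Suc n))"
    have n: "n \<ge> 2" using step assms by simp
    have ab: "a > 0" "a \<le> b" using n by (auto simp: a_def b_def)
    have "b - a = ln (real (Suc n) / real n)" using n by (simp add: a_def b_def ln_div)
    also have "\<dots> \<le> real (Suc n) / real n - 1" using n by (intro ln_le_minus_one) simp
    also have "\<dots> \<le> 1" using n by (simp add: field_simps)
    finally have ba: "b - a \<le> 1" .
    have setA: "{p. prime p \<and> p \<le> Suc n}
        = (if prime (Suc n) then insert (Suc n) {p. prime p \<and> p \<le> n} else {p. prime p \<and> p \<le> n})"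
      by (auto simp: le_Suc_eq)
    have setT: "{p. prime p \<and> M < p \<and> p \<le> Suc n}
        = (if prime (Suc n) then insert (Suc n) {p. prime p \<and> M < p \<and> p \<le> n}
           else {p. prime p \<and> M < p \<and> p \<le> n})"
      using step by (auto simp: le_Suc_eq)
    have finA: "finite {p. prime p \<and> p \<le> n}" by simp
    have finT: "finite {p. prime p \<and> M < p \<and> p \<le> n}" by simp
    have "T (Suc n) - T n = (A (Suc n) - A n) / b"
      unfolding T_def A_def setA setT b_def using n finA finT by (simp add: sum.insert)
    also have "A (Suc n) - A n = b - a + (r (Suc n) - r n)" by (simp add: r_def a_def b_def)
    finally have T: "T (Suc n) = T n + (b - a) / b + r (Suc n) / b - r n / b"
      by (simp add: add_divide_distrib diff_divide_distrib)
    have e: "1 / a - 1 / b \<ge> 0" using ab by (simp add: field_simps)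
    have "ln b - ln a = ln (b / a)" using ab by (simp add: ln_div)
    also have "\<dots> \<le> b / a - 1" using ab by (intro ln_le_minus_one) auto
    also have "\<dots> = (b - a) / b + (b - a) * (1 / a - 1 / b)" using ab by (simp add: field_simps)
    also have "(b - a) * (1 / a - 1 / b) \<le> 1 * (1 / a - 1 / b)" using ba e by (rule mult_right_mono)
    finally have l: "ln b - ln a - (1 / a - 1 / b) \<le> (b - a) / b" by simp
    have "- 5 * (1 / a - 1 / b) \<le> r n * (1 / a - 1 / b)"
      using r[OF n] e by (intro mult_right_mono) auto
    hence "- 5 * (1 / a - 1 / b) \<le> r n / a - r n / b" by (simp add: algebra_simps)
    with step.IH l T show ?case unfolding a_def [symmetric] b_def [symmetric] by (simp add: algebra_simps)
  qed
  define i j where "i = 1 / ln (real M)" and "j = 1 / ln (real N)"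
  have ij: "i \<ge> 0" "j \<ge> 0" using assms by (auto simp: i_def j_def)
  \<comment> \<open>The boundary term at \<open>M\<close> costs another \<open>5 * i\<close>, making
    11, while the one at \<open>N\<close> costs \<open>5 * j\<close> and is covered by the gain
    \<open>6 * j\<close>.\<close>
  have "r M * i \<le> 5 * i" using r[OF assms(1)] ij by (intro mult_right_mono) auto
  moreover have "- 5 * j \<le> r N * j" using r[of N] assms ij by (intro mult_right_mono) auto
  moreover have combine: "X - 11 * i \<le> S"
    if "a \<le> 5 * i" "- 5 * j \<le> b" "X - 6 * (i - j) - a \<le> S - b" for X S a b
    using that ij by (simp add: algebra_simps)
  moreover have "T N - r N * j \<ge> ln (ln (real N)) - ln (ln (real M)) - 6 * (i - j) - r M * i"
    using main by (simp add: i_def j_def)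
  ultimately have "T N \<ge> ln (ln (real N)) - ln (ln (real M)) - 11 * i"
    using combine by blast
  thus ?thesis by (simp add: T_def i_def)
qed

section \<open>Counting squarefree numbers\<close>

text \<open>Double counting: a pair \<open>(T, p)\<close> with \<open>p\<close> outside
  \<open>T\<close> corresponds to the set \<open>U = insert p T\<close> with a marked element, and
  \<open>U\<close> has \<open>Suc k\<close> elements to mark.\<close>

lemma sum_subsets_Suc:
  fixes f :: "'a \<Rightarrow> real"
  assumes "finite Q"
  shows "(\<Sum>T | T \<subseteq> Q \<and> card T = k. \<Sum>p\<in>Q-T. prod f T * f p)
    = real (Suc k) * (\<Sum>T | T \<subseteq> Q \<and> card T = Suc k. prod f T)"
proof -
  have fin: "finite {T. T \<subseteq> Q \<and> card T = j}" for j using assms by simp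
  have finT: "finite T" if "T \<subseteq> Q" for T using that assms finite_subset by blast
  have "(\<Sum>T | T \<subseteq> Q \<and> card T = k. \<Sum>p\<in>Q-T. prod f T * f p)
      = (\<Sum>(T,p)\<in>(SIGMA T:{T. T \<subseteq> Q \<and> card T = k}. Q - T). prod f T * f p)"
    using assms fin by (subst sum.Sigma) auto
  also have "\<dots> = (\<Sum>(U,p)\<in>(SIGMA U:{U. U \<subseteq> Q \<and> card U = Suc k}. U). prod f U)"
    by (rule sum.reindex_bij_witness[where i = "\<lambda>(U,p). (U - {p}, p)" and j = "\<lambda>(T,p). (insert p T, p)"])
       (auto simp: finT insert_absorb mult.commute intro: finT)
  also have "\<dots> = (\<Sum>U | U \<subseteq> Q \<and> card U = Suc k. \<Sum>p\<in>U. prod f U)"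
    using fin finT by (subst sum.Sigma) auto
  also have "\<dots> = (\<Sum>U | U \<subseteq> Q \<and> card U = Suc k. real (Suc k) * prod f U)"
    by (intro sum.cong) auto
  finally show ?thesis by (simp add: sum_distrib_left)
qed

text \<open>Extending a \<open>k\<close>-set \<open>T\<close> by an element outside it gives total
  weight at least \<open>sum f Q - k * e\<close>, because \<open>T\<close> itself carries at most
  \<open>k * e\<close>. The double counting identity turns this into an induction on
  \<open>k\<close>.\<close>

lemma sum_subsets_prod_ge:
  fixes f :: "'a \<Rightarrow> real"
  assumes "finite Q" "\<And>q. q \<in> Q \<Longrightarrow> 0 \<le> f q" "\<And>q. q \<in> Q \<Longrightarrow> f q \<le> e"
    and "0 \<le> e" "real k * e \<le> sum f Q"
  shows "(\<Sum>T | T \<subseteq> Q \<and> card T = k. prod f T) \<ge> (sum f Q - real k * e) ^ k / fact k"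
  using assms(5)
proof (induction k)
  case 0
  have "{T. T \<subseteq> Q \<and> card T = 0} = {{}}" using assms(1) by (auto dest: finite_subset)
  thus ?case by simp
next
  case (Suc k)
  let ?S = "sum f Q" and ?E = "\<lambda>k. \<Sum>T | T \<subseteq> Q \<and> card T = k. prod f T"
  have ke: "real k * e \<le> real (Suc k) * e" using assms(4) by (intro mult_right_mono) auto
  have pos: "0 \<le> ?S - real (Suc k) * e" using Suc.prems by simp
  have "(?S - real (Suc k) * e) ^ k * (?S - real (Suc k) * e)
      \<le> (?S - real k * e) ^ k * (?S - real k * e)"
    using pos ke by (intro mult_mono power_mono zero_le_power) auto
  also have "(?S - real k * e) ^ k \<le> fact k * ?E k"
    using Suc.IH Suc.prems ke by (simp add: divide_le_eq mult.commute)
  also have "fact k * ?E k * (?S - real k * e)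
      = fact k * (\<Sum>T | T \<subseteq> Q \<and> card T = k. prod f T * (?S - real k * e))"
    by (simp add: sum_distrib_right mult.assoc)
  also have "(\<Sum>T | T \<subseteq> Q \<and> card T = k. prod f T * (?S - real k * e))
      \<le> (\<Sum>T | T \<subseteq> Q \<and> card T = k. \<Sum>p\<in>Q-T. prod f T * f p)"
  proof (intro sum_mono)
    fix T assume T: "T \<in> {T. T \<subseteq> Q \<and> card T = k}"
    hence "sum f T \<le> real k * e"
      using sum_bounded_above[of T f e] assms(3) by auto
    moreover have "sum f (Q - T) = ?S - sum f T"
      using T assms(1) by (intro sum_diff) auto
    moreover have "prod f T \<ge> 0" using T assms(2) by (auto intro!: prod_nonneg)
    ultimately have "prod f T * (?S - real k * e) \<le> prod f T * sum f (Q - T)"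
      by (intro mult_left_mono) auto
    thus "prod f T * (?S - real k * e) \<le> (\<Sum>p\<in>Q-T. prod f T * f p)"
      by (simp add: sum_distrib_left)
  qed
  also have "\<dots> = real (Suc k) * ?E (Suc k)" by (rule sum_subsets_Suc[OF assms(1)])
  finally have "(?S - real (Suc k) * e) ^ Suc k \<le> fact (Suc k) * ?E (Suc k)"
    using pos ke by (simp add: mult_ac mult_right_mono mult_left_mono)
  thus ?case by (simp add: divide_le_eq mult.commute)
qed

section \<open>Squarefree numbers as products of sets of primes\<close>

lemma prime_factors_prod_primes:
  fixes U :: "nat set"
  assumes "finite U" "\<And>p. p \<in> U \<Longrightarrow> prime p"
  shows "prime_factors (\<Prod>U) = U"
  using assms by (subst prime_factors_prod) (auto simp: prime_prime_factors dest: assms(2))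

text \<open>A number with \<open>Suc k\<close> prime factors arises from at most \<open>Suc k\<close> of the pairs \<open>(T, p)\<close>,
  since \<open>p\<close> determines \<open>T\<close>.\<close>
lemma card_squarefree_ge_sum:
  fixes x m k :: nat and Q :: "nat set"
  assumes "finite Q" "\<And>q. q \<in> Q \<Longrightarrow> prime q \<and> \<not> q dvd m"
  shows "(\<Sum>T | T \<subseteq> Q \<and> card T = k. card {p. prime p \<and> p \<le> x div \<Prod>T \<and> \<not> p dvd m \<and> p \<notin> T})
    \<le> Suc k * card {n. 0 < n \<and> n \<le> x \<and> card (prime_factors n) = Suc k \<and> coprime n m \<and> squarefree n}"
    (is "(\<Sum>T\<in>?TT. card (?B T)) \<le> _ * card ?N")
proof -
  have finN: "finite ?N" by (rule finite_subset[of _ "{..x}"]) auto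
  have finTT: "finite ?TT" using assms(1) by simp
  have finB: "finite (?B T)" for T by (rule finite_subset[of _ "{..x div \<Prod>T}"]) auto
  have T: "finite T" "\<And>p. p \<in> T \<Longrightarrow> prime p" "prime_factors (\<Prod>T) = T" if "T \<in> ?TT" for T
  proof -
    show 1: "finite T" "\<And>p. p \<in> T \<Longrightarrow> prime p" using that assms finite_subset by blast+
    thus "prime_factors (\<Prod>T) = T" by (rule prime_factors_prod_primes)
  qed
  \<comment> \<open>Recording \<open>p\<close> next to the product makes the map injective; the
    image lies among the numbers with one marked prime factor.\<close>
  define h where "h = (\<lambda>(T,p). (p * \<Prod>T, p :: nat))"
  have "card (SIGMA T:?TT. ?B T) \<le> card (SIGMA n:?N. prime_factors n)"
  proof (rule card_inj_on_le[of h])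
    show "inj_on h (SIGMA T:?TT. ?B T)"
    proof (rule inj_onI)
      fix a b assume ab: "a \<in> (SIGMA T:?TT. ?B T)" "b \<in> (SIGMA T:?TT. ?B T)" "h a = h b"
      obtain S p where a: "a = (S, p)" by (cases a)
      obtain T q where b: "b = (T, q)" by (cases b)
      have S: "S \<in> ?TT" and p: "prime p" using ab(1) by (simp_all add: a)
      have T': "T \<in> ?TT" using ab(2) by (simp add: b)
      have pq: "p = q" using ab(3) by (simp add: a b h_def)
      have "(p * \<Prod>S, p) = (q * \<Prod>T, q)" using ab(3) by (simp only: a b h_def prod.case)
      hence "p * \<Prod>S = q * \<Prod>T" by (rule Pair_inject)
      hence "p * \<Prod>S = p * \<Prod>T" by (simp only: pq)
      hence "\<Prod>S = \<Prod>T" using prime_gt_0_nat[OF p] by simp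
      hence "S = T" using T(3)[OF S] T(3)[OF T'] by metis
      thus "a = b" using pq by (simp add: a b)
    qed
    show "h ` (SIGMA T:?TT. ?B T) \<subseteq> (SIGMA n:?N. prime_factors n)"
    proof (rule image_subsetI)
      fix a assume a: "a \<in> (SIGMA T:?TT. ?B T)"
      obtain S p where Sp: "a = (S, p)" by (cases a)
      have S: "S \<in> ?TT" and p: "prime p" "p \<le> x div \<Prod>S" "\<not> p dvd m" "p \<notin> S"
        using a by (auto simp: Sp)
      define U where "U = insert p S"
      have U: "finite U" "\<And>q. q \<in> U \<Longrightarrow> prime q" "\<And>q. q \<in> U \<Longrightarrow> \<not> q dvd m" "card U = Suc k"
        using S p T[OF S] assms(2) by (auto simp: U_def)
      have prodU: "\<Prod>U = p * \<Prod>S" using T(1)[OF S] p(4) by (simp add: U_def)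
      have pf: "prime_factors (\<Prod>U) = U" using U by (intro prime_factors_prod_primes)
      have "p * \<Prod>S \<le> x div \<Prod>S * \<Prod>S" using p(2) by (rule mult_right_mono) simp
      also have "\<dots> \<le> x" by simp
      finally have "\<Prod>U \<le> x" by (simp add: prodU)
      moreover have "\<Prod>U > 0" using U by (auto intro!: prod_pos simp: prime_gt_0_nat)
      moreover have "coprime (\<Prod>U) m"
        by (rule prod_coprime_left) (use U in \<open>auto intro: prime_imp_coprime\<close>)
      moreover have "squarefree (\<Prod>U)"
        by (rule squarefree_prod_coprime) (use U in \<open>auto intro: primes_coprime squarefree_prime\<close>)
      ultimately have "\<Prod>U \<in> ?N" using pf U by simp
      moreover have "p \<in> prime_factors (\<Prod>U)" unfolding pf by (simp add: U_def)
      ultimately show "h a \<in> (SIGMA n:?N. prime_factors n)" by (simp add: h_def Sp prodU)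
    qed
    show "finite (SIGMA n:?N. prime_factors n)" using finN by auto
  qed
  also have "card (SIGMA n:?N. prime_factors n) = (\<Sum>n\<in>?N. card (prime_factors n))"
    using finN by (intro card_SigmaI) auto
  also have "\<dots> = Suc k * card ?N" by (simp add: sum_constant mult.commute)
  finally show ?thesis using finTT finB by (simp add: card_SigmaI)
qed

section \<open>Explicit counts of usable primes\<close>

lemma ln_le_of_ge_27:
  assumes "v \<ge> (27 :: real)"
  shows "ln v \<le> 14 / 100 * v"
proof -
  have "exp 1 \<ge> (5/2 :: real)" using exp_lower_Taylor_quadratic[of "1::real"] by simp
  hence "exp 1 ^ 3 \<ge> (5/2 :: real) ^ 3" by (intro power_mono) auto
  hence e3: "exp 3 \<ge> (125/8 :: real)" by (simp add: exp_of_nat_mult[of 3 1, symmetric, simplified] power_divide)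
  \<comment> \<open>Tangent line of \<open>ln\<close> at \<open>exp 3\<close>; its constant 2 is at
    most \<open>2 / 27 * v\<close> in the given range.\<close>
  have "ln (v / exp 3) \<le> v / exp 3 - 1" using assms by (intro ln_le_minus_one) auto
  hence "ln v \<le> v / exp 3 + 2" using assms by (simp add: ln_div)
  also have "v / exp 3 \<le> v / (125/8)" using assms e3 by (intro divide_left_mono) auto
  finally show ?thesis using assms by simp
qed

text \<open>The surplus \<open>z + y\<close> is what will be discarded: prime factors of the modulus
  and primes already chosen. It takes at most about 0.44 of \<open>u / ln u\<close>, whereas the
  lower bound for \<open>psi\<close> supplies about 2/3.\<close>

lemma prime_count_ge:
  fixes u y z :: nat
  assumes "u \<ge> 19682" "z ^ 3 \<le> (u + 1)\<^sup>2" "y\<^sup>2 \<le> z"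
  shows "real z + real y + real u / (10 * ln (real u)) \<le> real (card {p. prime p \<and> p \<le> u})"
proof -
  \<comment> \<open>Here \<open>19682 = 27 ^ 3 - 1\<close>, so \<open>v\<close> is at least 27; the
    hypotheses become \<open>z \<le> v\<^sup>2\<close> and \<open>y \<le> v\<close>.\<close>
  define v where "v = root 3 (real u + 1)"
  have v3: "v ^ 3 = real u + 1" by (simp add: v_def)
  have v: "v \<ge> 27"
  proof -
    have "root 3 (27 ^ 3) \<le> v" unfolding v_def using assms(1) by (intro real_root_le_mono) auto
    thus ?thesis by (simp add: real_root_power_cancel)
  qed
  have lnu: "ln (real u) > 0" using assms(1) by simp
  have "ln (real u) \<le> ln (v ^ 3)" unfolding v3 using assms(1) by simp
  also have "\<dots> = 3 * ln v" using v by (simp add: ln_realpow)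
  also have "\<dots> \<le> 3 * (14 / 100 * v)" using ln_le_of_ge_27[OF v] by simp
  finally have lnu_le: "ln (real u) \<le> 42 / 100 * v" by simp
  have "real (z ^ 3) \<le> real ((u + 1)\<^sup>2)" using assms(2) by (simp only: of_nat_le_iff)
  hence "real z ^ 3 \<le> (v ^ 3)\<^sup>2" unfolding v3 by (simp add: add.commute)
  also have "\<dots> = (v\<^sup>2) ^ 3" by (simp add: power2_eq_square power3_eq_cube mult_ac)
  finally have z: "real z \<le> v\<^sup>2" using power_mono_iff[of "real z" "v\<^sup>2" 3] by simp
  have "(real y)\<^sup>2 \<le> real z" using assms(3) by (metis of_nat_le_iff of_nat_power)
  hence "(real y)\<^sup>2 \<le> v\<^sup>2" using z by linarith
  hence y: "real y \<le> v" by (rule power2_le_imp_le) (use v in simp)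
  have vv: "v \<le> v\<^sup>2 / 27" using v mult_right_mono[OF v, of v] by (simp add: power2_eq_square)
  have "(real z + real y) * ln (real u) \<le> (v\<^sup>2 + v\<^sup>2 / 27) * (42 / 100 * v)"
    using z y vv lnu lnu_le by (intro mult_mono) auto
  also have "\<dots> = 42/100 * 28/27 * (real u + 1)" by (simp add: v3 [symmetric] power2_eq_square power3_eq_cube)
  finally have zy: "(real z + real y) * ln (real u) \<le> 44/100 * (real u + 1)" using assms(1) by simp
  define k where "k = u div 2"
  have "u \<le> 2 * k + 1" unfolding k_def by arith
  hence "real u \<le> 2 * real k + 1" by linarith
  hence k: "real k \<ge> (real u - 1) / 2" "2 * k \<le> u" "k > 0"
    using assms(1) unfolding k_def by simp_all
  have v2u: "v \<le> (real u + 1) / 729"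
  proof -
    have "v * 27\<^sup>2 \<le> v * v\<^sup>2" using v by (intro mult_left_mono power_mono) auto
    thus ?thesis by (simp add: v3 [symmetric] power2_eq_square power3_eq_cube)
  qed
  have ln4: "ln 4 \<ge> (4/3 :: real)"
    using ln_realpow[of 2 2] ln2_ge_two_thirds by simp
  have "(real u - 1) * (2/3) \<le> real k * ln 4"
    using mult_mono[OF k(1) ln4] k by simp
  moreover have "ln (2 * real k) \<le> ln (real u)" using k by simp
  moreover have "psi (2 * k) \<le> psi u"
    unfolding psi_def using k by (intro sum_mono2) (auto simp: mangoldt_nonneg)
  ultimately have "psi u \<ge> (real u - 1) * (2/3) - 42/100 * v"
    using psi_double_ge[OF k(3)] lnu_le by linarith
  hence "psi u \<ge> 44/100 * (real u + 1) + real u / 10"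
    using v2u assms(1) by (simp add: field_simps)
  hence "(real z + real y) * ln (real u) + real u / 10
      \<le> real (card {p. prime p \<and> p \<le> u}) * ln (real u)"
    using psi_le_prime_count[of u] zy by linarith
  thus ?thesis using lnu by (simp add: field_simps)
qed

text \<open>For \<open>k\<close> primes up to \<open>W\<close> with product \<open>P\<close>, the
  quotient \<open>x div P\<close> is still at least \<open>W\<close>, so enough primes remain for
  the last factor. The 20 is the 10 of the prime count doubled by rounding, and \<open>Suc k\<close>
  is the multiplicity of the products.\<close>

lemma squarefree_count_ge:
  fixes x m k z W :: nat and Q :: "nat set"
  assumes W: "W \<ge> 19682" "W ^ Suc k \<le> x"
    and z: "z ^ 3 \<le> (W + 1)\<^sup>2" "(Suc k)\<^sup>2 \<le> z" "card (prime_factors m) \<le> z"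
    and m: "m > 0"
    and Q: "\<And>q. q \<in> Q \<Longrightarrow> prime q \<and> \<not> q dvd m \<and> q \<le> W"
  shows "real x / (20 * ln (real x) * real (Suc k))
      * (\<Sum>T | T \<subseteq> Q \<and> card T = k. \<Prod>p\<in>T. 1 / real p)
    \<le> real (card {n. 0 < n \<and> n \<le> x \<and> card (prime_factors n) = Suc k \<and> coprime n m \<and> squarefree n})"
    (is "_ \<le> real (card ?N)")
proof -
  have finQ: "finite Q" by (rule finite_subset[of _ "{..W}"]) (use Q in auto)
  let ?B = "\<lambda>T. {p. prime p \<and> p \<le> x div \<Prod>T \<and> \<not> p dvd m \<and> p \<notin> T}"
  have "W \<le> W ^ Suc k" using W(1) by (intro self_le_power) auto
  hence x: "x \<ge> 19682" using W by linarith
  hence lnx: "ln (real x) > 0" by simp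
  have B: "real x / (20 * ln (real x)) * (\<Prod>p\<in>T. 1 / real p) \<le> real (card (?B T))"
    if T: "T \<subseteq> Q" "card T = k" for T
  proof -
    define P where "P = \<Prod>T"
    define u where "u = x div P"
    have finT: "finite T" using T finQ finite_subset by blast
    have P0: "P > 0" unfolding P_def using T Q by (auto intro!: prod_pos simp: prime_gt_0_nat)
    have "P \<le> (\<Prod>p\<in>T. W)" unfolding P_def using T Q by (intro prod_mono) auto
    hence "W * P \<le> W ^ Suc k" using T by simp
    hence "W * P \<le> x" using W by linarith
    hence uW: "u \<ge> W" using P0 by (simp add: u_def less_eq_div_iff_mult_less_eq)
    have ux: "u \<le> x" by (simp add: u_def)
    have "x < Suc u * P" using dividend_less_times_div[OF P0, of x] by (simp add: u_def mult.commute)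
    also have "\<dots> \<le> 2 * u * P" using uW W(1) by (intro mult_right_mono) auto
    finally have "real x \<le> 2 * real u * real P"
      by (metis less_imp_le of_nat_le_iff of_nat_mult of_nat_numeral)
    hence xP: "real x / real P \<le> 2 * real u" using P0 by (simp add: divide_le_eq)
    have "(W + 1)\<^sup>2 \<le> (u + 1)\<^sup>2" using uW by (intro power_mono) auto
    hence "z ^ 3 \<le> (u + 1)\<^sup>2" using z(1) by linarith
    hence "real z + real (Suc k) + real u / (10 * ln (real u)) \<le> real (card {p. prime p \<and> p \<le> u})"
      using uW W z by (intro prime_count_ge) auto
    \<comment> \<open>A prime up to \<open>u\<close> is usable, or divides \<open>m\<close>, or lies
      in \<open>T\<close>.\<close>
    moreover have "card {p. prime p \<and> p \<le> u} \<le> card (?B T \<union> (prime_factors m \<union> T))"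
      using finT m by (intro card_mono) (auto simp: u_def P_def in_prime_factors_iff)
    moreover have "card (?B T \<union> (prime_factors m \<union> T)) \<le> card (?B T) + (card (prime_factors m) + card T)"
      by (intro order.trans[OF card_Un_le] add_mono card_Un_le order.refl)
    ultimately have B_ge: "real u / (10 * ln (real u)) \<le> real (card (?B T))"
      using z(3) T(2) by linarith
    have prod_eq: "(\<Prod>p\<in>T. 1 / real p) = 1 / real P" by (simp add: P_def prod_dividef)
    have "real x / (20 * ln (real x)) * (\<Prod>p\<in>T. 1 / real p)
        = real x / real P / (20 * ln (real x))"
      unfolding prod_eq by simp
    also have "\<dots> \<le> 2 * real u / (20 * ln (real x))"
      using xP lnx by (intro divide_right_mono) auto
    also have "\<dots> = real u / (10 * ln (real x))" by simp
    also have "\<dots> \<le> real u / (10 * ln (real u))"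
      using uW W(1) ux by (intro divide_left_mono mult_pos_pos) auto
    also note B_ge
    finally show ?thesis .
  qed
  have "real x / (20 * ln (real x)) * (\<Sum>T | T \<subseteq> Q \<and> card T = k. \<Prod>p\<in>T. 1 / real p)
      \<le> (\<Sum>T | T \<subseteq> Q \<and> card T = k. real (card (?B T)))"
    unfolding sum_distrib_left by (intro sum_mono B) auto
  also have "\<dots> = real (\<Sum>T | T \<subseteq> Q \<and> card T = k. card (?B T))" by simp
  also have "\<dots> \<le> real (Suc k * card ?N)"
    unfolding of_nat_le_iff by (rule card_squarefree_ge_sum[OF finQ]) (use Q in auto)
  also have "\<dots> = real (Suc k) * real (card ?N)" by (rule of_nat_mult)
  finally have "real x / (20 * ln (real x)) * (\<Sum>T | T \<subseteq> Q \<and> card T = k. \<Prod>p\<in>T. 1 / real p)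
      / real (Suc k) \<le> real (Suc k) * real (card ?N) / real (Suc k)"
    by (rule divide_right_mono) simp
  also have "\<dots> = real (card ?N)" by (simp del: of_nat_Suc)
  finally show ?thesis by (simp del: of_nat_Suc)
qed

text \<open>Above \<open>M\<close>, about \<open>z powr (5/4)\<close>, reciprocals are so small that
  losing the prime factors of \<open>m\<close> costs at most 1/2500, as does the correction
  \<open>k / M\<close> for repeated elements. The main term comes from Mertens' second
  theorem.\<close>

lemma prime_sum_ge:
  fixes k m z W :: nat and l :: real
  defines "M \<equiv> nat \<lceil>real z powr (5/4)\<rceil>"
  assumes z: "ln (real z) \<ge> 10000" and l: "3 / 2 * ln (real z) \<le> l" "l - 1 \<le> ln (real W)"
    and W: "W > 0" and k: "k \<le> z" and m: "card (prime_factors m) \<le> z" "m > 0"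
  shows "(\<Sum>p | prime p \<and> M < p \<and> p \<le> W \<and> \<not> p dvd m. 1 / real p) - real k * (1 / real M)
     \<ge> ln (2 * l / ln (real z)) - ln (29 / 10)"
proof -
  define a where "a = ln (real z)"
  have z0: "z > 0" using z by (cases "z = 0") auto
  have a: "a \<ge> 10000" "real z = exp a" using z z0 by (auto simp: a_def)
  have zp: "real z powr (5/4) = exp (5/4 * a)" by (simp add: powr_def a_def z0)
  have M_ge: "real M \<ge> exp (5/4 * a)" unfolding M_def zp by linarith
  have M0: "M > 0" using M_ge exp_gt_zero[of "5/4 * a"] by (cases "M = 0") auto
  have M_le: "real M \<le> exp (5/4 * a) + 1" unfolding M_def zp by (simp add: of_nat_nat)
  have lnM_ge: "ln (real M) \<ge> 5/4 * a" using M_ge M0 by (subst ln_ge_iff) auto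
  have "real M \<le> exp 1 * exp (5/4 * a)"
  proof -
    have "exp (5/4 * a) \<ge> 1" using a by simp
    moreover have "2 * exp (5/4 * a) \<le> exp 1 * exp (5/4 * a)"
      using exp_ge_add_one_self[of 1] by (intro mult_right_mono) auto
    ultimately show ?thesis using M_le by linarith
  qed
  hence "real M \<le> exp (1 + 5/4 * a)" by (simp add: exp_add)
  hence "ln (real M) \<le> 1 + 5/4 * a" using M0 by (metis ln_exp ln_le_cancel_iff exp_gt_zero of_nat_0_less_iff)
  hence lnM_le: "ln (real M) \<le> 4/3 * a" using a by linarith
  have lnW: "ln (real W) \<ge> 95/100 * l" using l z by linarith
  hence "ln (real M) \<le> ln (real W)" using lnM_le l z unfolding a_def by linarith
  hence MW: "M \<le> W" using M0 W by simp
  have M2: "M \<ge> 2" using lnM_ge a M0 by (cases "M = 1") auto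
  have "z / real M \<le> exp a / exp (5/4 * a)" unfolding a(2) using M_ge M0 by (intro divide_left_mono) auto
  also have "\<dots> = inverse (exp (a / 4))" by (simp add: exp_diff [symmetric] exp_minus [symmetric])
  also have "\<dots> \<le> inverse (1 + a / 4)" using a exp_ge_add_one_self[of "a/4"] by (intro le_imp_inverse_le) auto
  also have "\<dots> \<le> inverse 2501" using a by (intro le_imp_inverse_le) auto
  finally have zM: "real z / real M \<le> 1 / 2500" by simp
  have "real k * (1 / real M) \<le> real z / real M" using k M0 by (simp add: divide_right_mono)
  hence kM: "real k * (1 / real M) \<le> 1 / 2500" using zM by linarith
  have "11 / ln (real M) \<le> 11 / 12500" using lnM_ge a by (intro divide_left_mono) auto
  hence mert: "(\<Sum>p | prime p \<and> M < p \<and> p \<le> W. 1 / real p)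
      \<ge> ln (ln (real W)) - ln (ln (real M)) - 11 / 12500"
    using mertens_second_lower[OF M2 MW] by linarith
  have "(\<Sum>p | prime p \<and> M < p \<and> p \<le> W. 1 / real p)
      = (\<Sum>p\<in>{p. prime p \<and> M < p \<and> p \<le> W \<and> \<not> p dvd m} \<union> {p. prime p \<and> M < p \<and> p \<le> W \<and> p dvd m}. 1 / real p)"
    by (intro sum.cong) auto
  also have "\<dots> = (\<Sum>p | prime p \<and> M < p \<and> p \<le> W \<and> \<not> p dvd m. 1 / real p)
      + (\<Sum>p | prime p \<and> M < p \<and> p \<le> W \<and> p dvd m. 1 / real p)"
    by (rule sum.union_disjoint) auto
  finally have split: "(\<Sum>p | prime p \<and> M < p \<and> p \<le> W. 1 / real p)
      = (\<Sum>p | prime p \<and> M < p \<and> p \<le> W \<and> \<not> p dvd m. 1 / real p)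
        + (\<Sum>p | prime p \<and> M < p \<and> p \<le> W \<and> p dvd m. 1 / real p)" .
  have "(\<Sum>p | prime p \<and> M < p \<and> p \<le> W \<and> p dvd m. 1 / real p)
      \<le> real (card {p. prime p \<and> M < p \<and> p \<le> W \<and> p dvd m}) * (1 / real M)"
    using M0 by (intro sum_bounded_above) (auto intro!: divide_left_mono)
  also have "card {p. prime p \<and> M < p \<and> p \<le> W \<and> p dvd m} \<le> card (prime_factors m)"
    using m by (intro card_mono) (auto simp: in_prime_factors_iff)
  hence "real (card {p. prime p \<and> M < p \<and> p \<le> W \<and> p dvd m}) * (1 / real M) \<le> real z * (1 / real M)"
    using m(1) by (intro mult_right_mono) auto
  also have "\<dots> \<le> 1 / 2500" using zM by simp
  finally have S: "(\<Sum>p | prime p \<and> M < p \<and> p \<le> W \<and> \<not> p dvd m. 1 / real p)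
      \<ge> ln (ln (real W)) - ln (ln (real M)) - 11 / 12500 - 1 / 2500"
    using mert split by linarith
  have la: "l > 0" using l z by linarith
  have "ln (95/100 * l) \<le> ln (ln (real W))" using lnW la by (subst ln_le_cancel_iff) auto
  moreover have "ln (ln (real M)) \<le> ln (4/3 * a)" using lnM_le lnM_ge a by (subst ln_le_cancel_iff) auto
  \<comment> \<open>The factor \<open>57/160\<close> is \<open>95/100\<close> divided by
    \<open>4/3\<close> and by 2.\<close>
  moreover have "ln (95/100 * l) = ln (4/3 * a) + (ln (2 * l / a) + ln (57/160))"
  proof -
    have "95/100 * l = 4/3 * a * (2 * l / a * (57/160))" using a by simp
    also have "ln \<dots> = ln (4/3 * a) + ln (2 * l / a * (57/160))" using la a by (intro ln_mult_pos) auto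
    also have "ln (2 * l / a * (57/160)) = ln (2 * l / a) + ln (57/160)"
      using la a by (intro ln_mult_pos) auto
    finally show ?thesis .
  qed
  \<comment> \<open>Since \<open>57/160 * (29/10) = 1653/1600\<close> exceeds 1, there is a surplus
    of about 0.03, enough for the errors \<open>11/12500\<close> and twice
    \<open>1/2500\<close>.\<close>
  moreover have "ln (57/160) + ln (29/10) + ln (1600/1653) = (0 :: real)"
  proof -
    have "ln (57/160) + ln (29/10) = ln (57/160 * (29/10) :: real)"
      by (rule ln_mult_pos [symmetric]) auto
    moreover have "ln (57/160 * (29/10)) + ln (1600/1653) = ln (57/160 * (29/10) * (1600/1653) :: real)"
      by (rule ln_mult_pos [symmetric]) auto
    ultimately show ?thesis by simp
  qed
  moreover have "ln (1600/1653 :: real) \<le> 1600/1653 - 1" by (rule ln_le_minus_one) simp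
  ultimately show ?thesis using S kM unfolding a_def [symmetric] by linarith
qed

section \<open>The range of the parameters\<close>

lemma exp_1_le_11_4: "exp 1 \<le> (11/4 :: real)"
proof -
  have "exp (1/50) \<le> (2551/2500 :: real)" using exp_bound[of "1/50 :: real"] by (simp add: power2_eq_square)
  hence "exp (1/50) ^ 50 \<le> (2551/2500 :: real) ^ 50" by (intro power_mono) auto
  also have "\<dots> \<le> 11/4" by (simp add: power_divide)
  finally show ?thesis by (simp add: exp_of_nat_mult [symmetric])
qed

text \<open>Bounding \<open>exp 1\<close> by \<open>11/4\<close> reduces rational lower bounds for
  logarithms to comparing powers of rationals.\<close>

lemma less_ln_powerI:
  fixes v :: real
  assumes "(11/4) ^ i < v ^ j" "j > 0" "v > 0"
  shows "real i / real j < ln v"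
proof -
  have "exp (real i) \<le> (11/4 :: real) ^ i"
    using power_mono[OF exp_1_le_11_4, of i] by (simp add: exp_of_nat_mult [symmetric])
  hence "exp (real i) < v ^ j" using assms(1) by linarith
  hence "ln (exp (real i)) < ln (v ^ j)" using assms(3) by (subst ln_less_cancel_iff) auto
  thus ?thesis using assms by (simp add: ln_realpow field_simps)
qed

text \<open>By concavity \<open>ln\<close> lies above its chord, so it is enough to compare at the
  two end points.\<close>

lemma ln_gt_linear_between:
  fixes a b c t :: real
  assumes "0 < a" "a \<le> t" "t \<le> b" "c * a < ln a" "c * b < ln b"
  shows "c * t < ln t"
proof (cases "a = b")
  case False
  define s where "s = (t - a) / (b - a)"
  have s: "0 \<le> s" "s \<le> 1" using assms False by (auto simp: s_def field_simps)
  have "s * (b - a) = t - a" using False by (simp add: s_def)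
  hence t: "t = (1 - s) * a + s * b" by (simp add: algebra_simps)
  have "c * t = (1 - s) * (c * a) + s * (c * b)" by (simp add: t algebra_simps)
  also have "\<dots> < (1 - s) * ln a + s * ln b"
  proof (cases "s = 1")
    case False
    hence "(1 - s) * (c * a) < (1 - s) * ln a" using assms s by simp
    moreover have "s * (c * b) \<le> s * ln b" using assms s by (intro mult_left_mono) auto
    ultimately show ?thesis by linarith
  qed (use assms in simp)
  also have "\<dots> \<le> ln ((1 - s) * a + s * b)"
    using concave_onD[OF ln_concave, of s a b] assms s by simp
  finally show ?thesis by (simp add: t)
qed (use assms in auto)

text \<open>The two bounds on \<open>y\<close> leave gaps: \<open>y = 1, 2\<close> are excluded in turn, each time raising the
  lower bound for \<open>t = ln x\<close>.\<close>
lemma ln_x_ge_27: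
  fixes t :: real and y :: nat
  assumes "t \<ge> 19/10" "ln t \<le> real y" "real y * (3 * ln t) \<le> t"
  shows "t \<ge> 27"
proof -
  have l19: "19/30 < ln (19/10 :: real)"
    using less_ln_powerI[of 19 "19/10" 30] by (simp add: power_divide)
  have l14: "7/3 < ln (14 :: real)" using less_ln_powerI[of 7 14 3] by (simp add: power_divide)
  have l27: "3 < ln (27 :: real)" using less_ln_powerI[of 3 27 1] by (simp add: power_divide)
  have lnt: "ln t > 0" using assms(1) by simp
  \<comment> \<open>Integrality of \<open>y\<close> enters here: \<open>ln t > j - 1\<close> forces
    \<open>y \<ge> j\<close>.\<close>
  have bound: "real j * (3 * ln t) \<le> t" if "real j - 1 < ln t" for j :: nat
  proof -
    have "j \<le> y" using that assms(2) by linarith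
    hence "real j * (3 * ln t) \<le> real y * (3 * ln t)" using lnt by (intro mult_right_mono) auto
    thus ?thesis using assms(3) by linarith
  qed
  have ln_exp1: "ln t > 1"
  proof (rule ccontr)
    assume "\<not> ln t > 1"
    hence "exp (ln t) \<le> exp 1" by simp
    hence "t \<le> exp 1" using assms(1) by simp
    have "1/3 * t < ln t"
    proof (rule ln_gt_linear_between[of "19/10" t "exp 1"])
      show "1/3 * exp 1 < ln (exp 1 :: real)" using exp_1_le_11_4 by simp
    qed (use assms(1) l19 \<open>t \<le> exp 1\<close> in auto)
    thus False using bound[of 1] lnt by simp
  qed
  have "t > 14"
  proof (rule ccontr)
    assume "\<not> t > 14"
    hence "1/6 * t < ln t" using assms(1) l19 l14 by (intro ln_gt_linear_between[of "19/10" t 14]) auto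
    thus False using bound[of 2] ln_exp1 by simp
  qed
  hence "ln 14 < ln t" by simp
  hence ln2: "ln t > 2" using l14 by linarith
  show ?thesis
  proof (rule ccontr)
    assume "\<not> ?thesis"
    hence "1/9 * t < ln t" using assms(1) l19 l27 by (intro ln_gt_linear_between[of "19/10" t 27]) auto
    thus False using bound[of 3] ln2 by simp
  qed
qed

lemma ln_7_ge: "ln 7 \<ge> (19/10 :: real)"
  using less_ln_powerI[of 19 7 10] by (simp add: power_divide)

text \<open>The loss \<open>ln (29/10)\<close> must stay below \<open>ln 3\<close>, the least value
  of \<open>L\<close>, and \<open>ln L\<close> must be bounded away from 0.\<close>

lemma ln_29_10: "ln (29/10) < ln (3 :: real)" "ln (29/10 :: real) > 0" "ln (ln 3 :: real) > 0"
proof -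
  have "1 < ln (3 :: real)" using less_ln_powerI[of 1 3 1] by simp
  thus "ln (ln 3 :: real) > 0" by simp
qed auto

text \<open>Converts a subtracted constant into a change of exponent:
  \<open>- ln (1 - b / L)\<close> is at most a multiple of \<open>1 / L\<close>, and the factor
  \<open>ln L / ln l0\<close>, which is at least 1, makes it a multiple of
  \<open>ln L / L\<close>.\<close>

lemma powr_le_minus_const:
  fixes b l0 L :: real
  defines "C \<equiv> b / ((1 - b / l0) * ln l0)"
  assumes "0 < b" "b < l0" "1 < l0" "l0 \<le> L"
  shows "L powr (1 - C / L) \<le> L - b"
proof -
  define d where "d = 1 - b / l0"
  have d: "d > 0" using assms by (simp add: d_def)
  have lnL: "0 < ln l0" "ln l0 \<le> ln L" "L > 0" "b < L" using assms by auto
  define q where "q = 1 - b / L"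
  have dq: "d \<le> q" using assms by (auto simp: d_def q_def intro!: divide_left_mono)
  have q: "q > 0" using d dq by linarith
  have "- ln q = ln (1 / q)" using q by (simp add: ln_div)
  also have "\<dots> \<le> 1 / q - 1" using q by (intro ln_le_minus_one) auto
  also have "\<dots> = b / L / q" using q lnL by (simp add: q_def field_simps)
  also have "\<dots> \<le> b / L / d" using dq d assms by (intro divide_left_mono) auto
  also have "\<dots> = b / d / L * 1" by simp
  also have "\<dots> \<le> b / d / L * (ln L / ln l0)"
    using lnL d assms by (intro mult_left_mono) auto
  also have "\<dots> = C / L * ln L" by (simp add: C_def d_def)
  finally have "(1 - C / L) * ln L \<le> ln L + ln q" by (simp add: algebra_simps)
  also have "\<dots> = ln (L * q)" using q lnL by (simp add: ln_mult_pos)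
  also have "L * q = L - b" using lnL by (simp add: q_def algebra_simps)
  finally have "exp ((1 - C / L) * ln L) \<le> exp (ln (L - b))" by simp
  thus ?thesis using lnL by (simp add: powr_def)
qed

section \<open>Passage between natural numbers and integers\<close>

lemma card_prime_factors_nat_abs:
  fixes m :: int
  assumes "m \<noteq> 0"
  shows "card (prime_factors (nat \<bar>m\<bar>)) = omega m"
proof -
  have dvd_nat: "q dvd nat \<bar>m\<bar> \<longleftrightarrow> int q dvd m" for q
    by (subst int_dvd_int_iff [symmetric]) simp
  have "prime_factors m = int ` prime_factors (nat \<bar>m\<bar>)"
  proof (intro subset_antisym subsetI)
    fix p assume "p \<in> prime_factors m"
    hence p: "prime p" "p dvd m" by auto
    obtain q where q: "p = int q" using prime_ge_0_int[OF p(1)] by (metis nonneg_int_cases)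
    have "q \<in> prime_factors (nat \<bar>m\<bar>)" using p assms by (simp add: q in_prime_factors_iff dvd_nat)
    thus "p \<in> int ` prime_factors (nat \<bar>m\<bar>)" unfolding q by (rule imageI)
  next
    fix p assume "p \<in> int ` prime_factors (nat \<bar>m\<bar>)"
    then obtain q where q: "p = int q" "q \<in> prime_factors (nat \<bar>m\<bar>)" by (rule imageE)
    thus "p \<in> prime_factors m" using assms by (simp add: in_prime_factors_iff dvd_nat)
  qed
  thus ?thesis unfolding omega_def by (simp add: card_image)
qed

lemma squarefree_int_iff: "squarefree (int n) \<longleftrightarrow> squarefree n"
proof
  assume "squarefree n"
  show "squarefree (int n)"
  proof (rule squarefreeI)
    fix a :: int assume "a\<^sup>2 dvd int n"
    hence "int ((nat \<bar>a\<bar>)\<^sup>2) dvd int n" by simp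
    hence "(nat \<bar>a\<bar>)\<^sup>2 dvd n" by (simp only: int_dvd_int_iff)
    hence "nat \<bar>a\<bar> dvd 1" using \<open>squarefree n\<close> by (rule squarefreeD[rotated])
    thus "a dvd 1" by auto
  qed
next
  assume *: "squarefree (int n)"
  show "squarefree n"
  proof (rule squarefreeI)
    fix a assume "a\<^sup>2 dvd n"
    hence "(int a)\<^sup>2 dvd int n" by (simp flip: of_nat_power)
    hence "int a dvd 1" using * by (rule squarefreeD[rotated])
    thus "a dvd 1" by simp
  qed
qed

lemma card_squarefree_nat_le_sum_int:
  fixes x y m :: int
  assumes "m \<noteq> 0" "x \<ge> 0" "y \<ge> 0"
  shows "real (card {n. 0 < n \<and> n \<le> nat x \<and> card (prime_factors n) = nat y \<and> coprime n (nat \<bar>m\<bar>) \<and> squarefree n})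
     \<le> (\<Sum>n | 0 < n \<and> n \<le> x \<and> int (omega n) = y \<and> coprime n m \<and> squarefree n. 1)"
proof -
  let ?A = "{n. 0 < n \<and> n \<le> nat x \<and> card (prime_factors n) = nat y \<and> coprime n (nat \<bar>m\<bar>) \<and> squarefree n}"
  let ?B = "{n. 0 < n \<and> n \<le> x \<and> int (omega n) = y \<and> coprime n m \<and> squarefree n}"
  have "int ` ?A \<subseteq> ?B"
  proof (rule image_subsetI)
    fix n assume n: "n \<in> ?A"
    have "omega (int n) = nat y" using card_prime_factors_nat_abs[of "int n"] n by simp
    moreover have "coprime (int n) (int (nat \<bar>m\<bar>))" using n unfolding coprime_int_iff by simp
    hence "coprime (int n) m" by simp
    ultimately show "int n \<in> ?B" using n assms by (auto simp: squarefree_int_iff)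
  qed
  moreover have "finite ?B" by (rule finite_subset[of _ "{0..x}"]) auto
  ultimately have "card (int ` ?A) \<le> card ?B" by (intro card_mono)
  thus ?thesis by (simp add: card_image)
qed

text \<open>Here \<open>Suc k\<close> is the number of prime factors \<open>y\<close>; \<open>l\<close> below is the logarithm of \<open>x powr (1/y)\<close>.\<close>

locale admissible =
  fixes x m k z :: nat
  assumes x: "x \<ge> 7" and m: "m > 0"
    and z: "(Suc k)\<^sup>2 \<le> z" "card (prime_factors m) \<le> z"
    and y: "ln (ln (real x)) \<le> real (Suc k)" "real (Suc k) * (3 * ln (ln (real x))) \<le> ln (real x)"
    and z_le: "real z \<le> real x powr (2 / (3 * real (Suc k)))"
begin

section \<open>Consequences of the range conditions\<close>

definition "N = {n. 0 < n \<and> n \<le> x \<and> card (prime_factors n) = Suc k \<and> coprime n m \<and> squarefree n}"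
definition "L = ln (ln (real x) / (real (Suc k) * ln (sqrt (real z))))"
definition "l = ln (real x) / real (Suc k)"
definition "W = nat \<lfloor>exp l\<rfloor>"

lemma ln_x: "ln (real x) \<ge> 27"
proof -
  have "ln 7 \<le> ln (real x)" using x by simp
  hence "ln (real x) \<ge> 19/10" using ln_7_ge by linarith
  thus ?thesis using y by (rule ln_x_ge_27)
qed

lemma lnln_x: "ln (ln (real x)) > 3"
proof -
  have "3 < ln (27 :: real)" using less_ln_powerI[of 3 27 1] by (simp add: power_divide)
  also have "\<dots> \<le> ln (ln (real x))" using ln_x by simp
  finally show ?thesis .
qed

lemma k_ge: "k \<ge> 3"
  using lnln_x y(1) by linarith

lemma z_ge: "real z \<ge> 16" "ln (real z) \<ge> 2"
proof -
  have "(4::nat)\<^sup>2 \<le> (Suc k)\<^sup>2" using k_ge by (intro power_mono) auto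
  thus z16: "real z \<ge> 16" using z(1) by simp
  have "exp 2 = exp 1 * exp (1 :: real)" by (simp add: exp_add [symmetric])
  also have "\<dots> \<le> 3 * 3" using exp_le by (intro mult_mono) auto
  finally have "exp 2 \<le> real z" using z16 by linarith
  thus "ln (real z) \<ge> 2" using z16 by (subst ln_ge_iff) auto
qed

lemma l_bounds: "3 * ln (ln (real x)) \<le> l" "3 / 2 * ln (real z) \<le> l" "l > 0"
proof -
  show 1: "3 * ln (ln (real x)) \<le> l"
    using y(2) by (simp add: l_def le_divide_eq mult.commute)
  thus "l > 0" using lnln_x by linarith
  have "ln (real z) \<le> ln (real x powr (2 / (3 * real (Suc k))))"
    using z_le z_ge x by (subst ln_le_cancel_iff) auto
  also have "\<dots> = 2 / 3 * l" using x by (simp add: ln_powr l_def)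
  finally show "3 / 2 * ln (real z) \<le> l" by simp
qed

text \<open>\<open>exp l\<close> is at least \<open>ln x ^ 3\<close>, hence at least
  \<open>27 ^ 3\<close>. Rounding it down loses at most a factor 2, which is less than 1 on the
  logarithmic scale.\<close>

lemma W_bounds: "W \<ge> 19682" "W ^ Suc k \<le> x" "z ^ 3 \<le> (W + 1)\<^sup>2" "l - 1 \<le> ln (real W)"
proof -
  have "27 ^ 3 \<le> ln (real x) ^ 3" using ln_x by (intro power_mono) auto
  also have "\<dots> = exp (3 * ln (ln (real x)))"
    using ln_x exp_of_nat_mult[of 3 "ln (ln (real x))"] by simp
  also have "\<dots> \<le> exp l" using l_bounds by simp
  finally have el: "exp l \<ge> 19683" by simp
  thus W0: "W \<ge> 19682" unfolding W_def by linarith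
  have W: "real W \<le> exp l" "exp l < real W + 1" unfolding W_def using el by linarith+
  have "real W ^ Suc k \<le> exp l ^ Suc k" using W by (intro power_mono) auto
  also have "\<dots> = exp (real (Suc k) * l)" by (rule exp_of_nat_mult [symmetric])
  also have "\<dots> = real x" using x by (simp add: l_def)
  finally show "W ^ Suc k \<le> x" by (simp only: of_nat_power [symmetric] of_nat_le_iff)
  have "real z ^ 3 = exp (3 * ln (real z))" using z_ge exp_of_nat_mult[of 3 "ln (real z)"] by simp
  also have "\<dots> \<le> exp (2 * l)" using l_bounds(2) by simp
  also have "\<dots> = exp l ^ 2" using exp_of_nat_mult[of 2 l] by simp
  also have "\<dots> \<le> (real W + 1)\<^sup>2" using W by (intro power_mono) auto
  finally have "real (z ^ 3) \<le> real ((W + 1)\<^sup>2)" by (simp add: add.commute)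
  thus "z ^ 3 \<le> (W + 1)\<^sup>2" by (simp only: of_nat_le_iff)
  have "exp l \<le> 2 * real W" using W W0 by linarith
  also have "\<dots> \<le> exp 1 * real W" using exp_ge_add_one_self[of 1] by (intro mult_right_mono) auto
  finally have "ln (exp l) \<le> ln (exp 1 * real W)" using W0 by (subst ln_le_cancel_iff) auto
  thus "l - 1 \<le> ln (real W)" using W0 by (simp add: ln_mult_pos)
qed

text \<open>The square root puts the 2 in the numerator. The last bound is what lets a multiple of
  \<open>y / L\<close> absorb fixed constants.\<close>

lemma L_bounds: "L = ln (2 * l / ln (real z))" "ln 3 \<le> L" "L \<le> real (Suc k)" "1 \<le> real (Suc k) / L"
proof -
  show L: "L = ln (2 * l / ln (real z))"
    using z_ge by (simp add: L_def l_def ln_sqrt mult.commute)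
  have "2 * l / ln (real z) \<ge> 3" using l_bounds z_ge by (simp add: le_divide_eq)
  thus 3: "ln 3 \<le> L" unfolding L by simp
  have "2 * l / ln (real z) \<le> 2 * l / 2" using l_bounds z_ge by (intro divide_left_mono) auto
  also have "\<dots> \<le> ln (real x)" unfolding l_def using ln_x by (simp add: divide_le_eq mult_le_cancel_left1)
  finally have "L \<le> ln (ln (real x))" unfolding L using l_bounds z_ge ln_x by (subst ln_le_cancel_iff) auto
  thus Ly: "L \<le> real (Suc k)" using y(1) by linarith
  have "L > 0" using 3 ln_29_10 by linarith
  thus "1 \<le> real (Suc k) / L" using Ly by (simp add: le_divide_eq)
qed

lemma N_ge:
  assumes "\<And>q. q \<in> Q \<Longrightarrow> prime q \<and> \<not> q dvd m \<and> q \<le> W"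
  shows "real x / (20 * ln (real x) * real (Suc k))
      * (\<Sum>T | T \<subseteq> Q \<and> card T = k. \<Prod>p\<in>T. 1 / real p) \<le> real (card N)"
  unfolding N_def using W_bounds z m assms by (intro squarefree_count_ge[of W]) auto

text \<open>Serves the case of bounded \<open>z\<close>: after discarding prime factors of
  \<open>m\<close>, at least \<open>k\<close> primes up to \<open>W\<close> remain, so the symmetric
  sum is positive.\<close>

lemma N_nonempty: "card N \<ge> 1"
proof -
  define Q where "Q = {p. prime p \<and> p \<le> W \<and> \<not> p dvd m}"
  have finQ: "finite Q" by (simp add: Q_def)
  have "real z + real (Suc k) + real W / (10 * ln (real W)) \<le> real (card {p. prime p \<and> p \<le> W})"
    using W_bounds z(1) by (intro prime_count_ge)
  moreover have "real W / (10 * ln (real W)) \<ge> 0" using W_bounds(1) by simp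
  moreover have "card {p. prime p \<and> p \<le> W} \<le> card (Q \<union> prime_factors m)"
    using m finQ by (intro card_mono) (auto simp: Q_def in_prime_factors_iff)
  moreover have "card (Q \<union> prime_factors m) \<le> card Q + card (prime_factors m)" by (rule card_Un_le)
  ultimately have "k \<le> card Q" using z(2) by linarith
  then obtain T where T: "T \<subseteq> Q" "card T = k" by (rule obtain_subset_with_card_n)
  have pos: "(\<Prod>p\<in>T. 1 / real p) > 0" if "T \<subseteq> Q" for T
    using that by (intro prod_pos) (auto simp: Q_def prime_gt_0_nat)
  have "0 < (\<Prod>p\<in>T. 1 / real p)" using T pos by blast
  also have "\<dots> \<le> (\<Sum>T | T \<subseteq> Q \<and> card T = k. \<Prod>p\<in>T. 1 / real p)"
    using T finQ pos by (intro member_le_sum) (auto intro: less_imp_le)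
  finally have "0 < real x / (20 * ln (real x) * real (Suc k))
      * (\<Sum>T | T \<subseteq> Q \<and> card T = k. \<Prod>p\<in>T. 1 / real p)"
    using x ln_x by simp
  also have "\<dots> \<le> real (card N)" by (intro N_ge) (simp add: Q_def)
  finally show ?thesis by simp
qed

text \<open>All primes used exceed \<open>M\<close>, so the symmetric sum estimate applies with
  \<open>e = 1 / M\<close>; the factors \<open>Suc k\<close> and \<open>fact k\<close> merge into
  \<open>fact (Suc k)\<close>.\<close>

lemma N_ge_large:
  assumes "ln (real z) \<ge> 10000"
  shows "real x / ln (real x) * ((L - ln (29/10)) ^ k / (20 * fact (Suc k))) \<le> real (card N)"
proof -
  define M where "M = nat \<lceil>real z powr (5/4)\<rceil>"
  define Q where "Q = {p. prime p \<and> M < p \<and> p \<le> W \<and> \<not> p dvd m}"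
  have "k \<le> z" using power_increasing[of 1 2 "Suc k"] z(1) by simp
  hence S: "(\<Sum>p\<in>Q. 1 / real p) - real k * (1 / real M) \<ge> L - ln (29 / 10)"
    unfolding Q_def M_def L_bounds(1)
    using assms l_bounds W_bounds z m by (intro prime_sum_ge) auto
  have M: "M > 0" using z_ge unfolding M_def by simp
  have pos: "L - ln (29/10) > 0" using L_bounds(2) ln_29_10 by linarith
  have "(L - ln (29/10)) ^ k / fact k \<le> ((\<Sum>p\<in>Q. 1 / real p) - real k * (1 / real M)) ^ k / fact k"
    using S pos by (intro divide_right_mono power_mono) auto
  also have "\<dots> \<le> (\<Sum>T | T \<subseteq> Q \<and> card T = k. \<Prod>p\<in>T. 1 / real p)"
    using S pos M by (intro sum_subsets_prod_ge) (auto simp: Q_def intro!: divide_left_mono)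
  finally have "real x / (20 * ln (real x) * real (Suc k)) * ((L - ln (29/10)) ^ k / fact k)
      \<le> real x / (20 * ln (real x) * real (Suc k))
        * (\<Sum>T | T \<subseteq> Q \<and> card T = k. \<Prod>p\<in>T. 1 / real p)"
    using ln_x by (intro mult_left_mono) auto
  also have "\<dots> \<le> real (card N)" by (intro N_ge) (simp add: Q_def)
  finally show ?thesis by (simp add: mult_ac)
qed

end

lemma squarefree_count_lower:
  obtains C :: real where "C > 0"
    "\<And>x m k z. admissible x m k z \<Longrightarrow>
       real x / ln (real x)
         * (admissible.L x k z powr (real (Suc k) - C * (real (Suc k) / admissible.L x k z)) / fact (Suc k))
       \<le> real (card (admissible.N x m k))"
proof
  define b where "b = ln (29 / 10 :: real)"
  define c where "c = ln (ln 3 :: real)"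
  \<comment> \<open>The four summands of \<open>C\<close> pay for the loss \<open>b\<close> in
    \<open>L\<close>, the factor 20, the exponent \<open>k\<close> in place of \<open>Suc k\<close>,
    and the case of bounded \<open>z\<close>.\<close>
  define C1 where "C1 = b / ((1 - b / ln 3) * ln (ln 3))"
  define C2 where "C2 = ln 20 / c"
  define Z where "Z = exp (10000 :: real)"
  define C3 where "C3 = (exp Z + Z\<^sup>2) / c"
  define C where "C = C1 + C2 + 1 + C3"
  have c: "c > 0" "b > 0" "b < ln 3" using ln_29_10 by (simp_all add: b_def c_def)
  have ln3: "ln 3 > (1::real)" using less_ln_powerI[of 1 3 1] by simp
  have C1: "C1 > 0" using c by (simp add: C1_def flip: c_def)
  have C2: "C2 > 0" using c by (simp add: C2_def)
  have C3: "C3 > 0" using c by (simp add: C3_def add_pos_nonneg)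
  show "C > 0" using C1 C2 C3 by (simp add: C_def)
  fix x m k z assume "admissible x m k z"
  then interpret admissible x m k z .
  define y where "y = real (Suc k)"
  have L: "ln 3 \<le> L" "L \<le> y" "1 \<le> y / L" using L_bounds by (simp_all add: y_def)
  have L1: "L > 1" using L ln3 by linarith
  have lnL: "c \<le> ln L" unfolding c_def using L ln3 L1 by simp
  have "real x / ln (real x) * (L powr (y - C * (y / L)) / fact (Suc k)) \<le> real (card N)"
  proof (cases "ln (real z) \<ge> 10000")
    case True
    have "y - C * (y / L) + C2 \<le> (1 - C1 / L) * real k"
    proof -
      have "C1 * (real k / L) \<le> C1 * (y / L)"
        using C1 L1 by (intro mult_left_mono divide_right_mono) (auto simp: y_def)
      moreover have "(C2 + 1) * 1 \<le> (C2 + 1) * (y / L)" using L(3) C2 by (intro mult_left_mono) auto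
      moreover have "0 \<le> C3 * (y / L)" using L(3) C3 by (intro mult_nonneg_nonneg) linarith+
      moreover have "C * (y / L) = C1 * (y / L) + (C2 + 1) * (y / L) + C3 * (y / L)"
        unfolding C_def by (simp only: distrib_right)
      moreover have "(1 - C1 / L) * real k = real k - C1 * (real k / L)" by (simp add: algebra_simps)
      moreover have "y = real k + 1" by (simp add: y_def)
      \<comment> \<open>The products are replaced by variables, which leaves a linear
        inequality.\<close>
      moreover have "Y - CY + C2 \<le> D"
        if "s \<le> p1" "(C2 + 1) * 1 \<le> p2" "0 \<le> p3" "CY = p1 + p2 + p3" "D = real k - s" "Y = real k + 1"
        for Y CY D s p1 p2 p3 using that by (simp add: algebra_simps)
      ultimately show ?thesis by blast
    qed
    hence "L powr (y - C * (y / L) + C2) \<le> L powr ((1 - C1 / L) * real k)"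
      using L1 by (intro powr_mono) auto
    also have "\<dots> = (L powr (1 - C1 / L)) ^ k"
      using L1 by (simp add: powr_powr [symmetric] powr_realpow)
    also have "\<dots> \<le> (L - b) ^ k"
      unfolding C1_def using c ln3 L by (intro power_mono powr_le_minus_const) auto
    finally have "L powr (y - C * (y / L)) * L powr C2 \<le> (L - b) ^ k" by (simp add: powr_add)
    moreover have "20 \<le> L powr C2"
    proof -
      have "ln 20 = C2 * c" using c by (simp add: C2_def)
      also have "\<dots> \<le> C2 * ln L" using lnL C2 by (intro mult_left_mono) auto
      finally have "exp (ln 20) \<le> exp (C2 * ln L)" by (simp only: exp_le_cancel_iff)
      moreover have "exp (ln 20) = (20 :: real)" by simp
      moreover have "exp (C2 * ln L) = L powr C2" using L1 by (simp add: powr_def)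
      ultimately show ?thesis by linarith
    qed
    ultimately have "L powr (y - C * (y / L)) * 20 \<le> (L - b) ^ k"
      by (meson mult_left_mono order.trans powr_ge_zero)
    hence "L powr (y - C * (y / L)) / fact (Suc k) \<le> (L - b) ^ k / (20 * fact (Suc k))"
      by (simp add: field_simps del: fact_Suc)
    hence "real x / ln (real x) * (L powr (y - C * (y / L)) / fact (Suc k))
        \<le> real x / ln (real x) * ((L - b) ^ k / (20 * fact (Suc k)))"
      using ln_x by (intro mult_left_mono) auto
    also have "\<dots> \<le> real (card N)" unfolding b_def by (rule N_ge_large[OF True])
    finally show ?thesis .
  next
    case False
    have "ln (real z) < 10000" using False by simp
    hence zZ: "real z < Z" unfolding Z_def using z_ge by (metis exp_less_cancel_iff exp_ln_iff less_le_trans zero_less_numeral)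
    have "Suc k \<le> z" using power_increasing[of 1 2 "Suc k"] z(1) by simp
    hence yZ: "y \<le> Z" using zZ by (simp add: y_def)
    have "ln (real x) \<le> exp y"
      using y(1) ln_x by (metis y_def exp_le_cancel_iff exp_ln_iff less_le_trans zero_less_numeral)
    hence lnx: "ln (real x) \<le> exp Z" using yZ by (meson exp_le_cancel_iff order.trans)
    \<comment> \<open>Now \<open>y \<le> Z\<close> and \<open>ln x \<le> exp Z\<close>, and
      \<open>C3\<close> was chosen so that the claimed bound is at most 1, hence at most
      \<open>card N\<close>.\<close>
    have "ln (real x) + (y - C * (y / L)) * ln L \<le> 0"
    proof -
      have "y * ln L \<le> Z * Z"
        using yZ L L1 ln_le_minus_one[of L] by (intro mult_mono) auto
      moreover have "C3 * c \<le> C * (y / L) * ln L"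
      proof (rule mult_mono)
        have "C3 * 1 \<le> C * (y / L)"
          using C1 C2 C3 L(3) by (intro mult_mono) (auto simp: C_def)
        thus "C3 \<le> C * (y / L)" by simp
        thus "0 \<le> C * (y / L)" using C3 by linarith
      qed (use lnL c in auto)
      moreover have "C3 * c = exp Z + Z * Z" using c by (simp add: C3_def power2_eq_square)
      ultimately show ?thesis using lnx by (simp add: algebra_simps)
    qed
    hence "exp (ln (real x) + (y - C * (y / L)) * ln L) \<le> 1" by simp
    hence "real x * L powr (y - C * (y / L)) \<le> 1"
      using x L1 by (simp add: exp_add powr_def)
    moreover have "1 \<le> ln (real x) * fact (Suc k)"
    proof -
      have "1 * 1 \<le> ln (real x) * fact (Suc k)" using ln_x by (intro mult_mono fact_ge_1) auto
      thus ?thesis by simp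
    qed
    ultimately have "real x * L powr (y - C * (y / L)) / (ln (real x) * fact (Suc k)) \<le> 1"
      by (subst divide_le_eq_1_pos) linarith+
    thus ?thesis using N_nonempty by (simp del: fact_Suc)
  qed
  thus "real x / ln (real x) * (L powr (real (Suc k) - C * (real (Suc k) / L)) / fact (Suc k))
      \<le> real (card N)" by (simp only: y_def)
qed

text \<open>The term \<open>O(y/L)\<close> is the number \<open>\<theta>\<close>, with one
  \<open>C\<close> for all parameters. From \<open>x \<ge> 7\<close> the range conditions already
  force \<open>ln x \<ge> 27\<close>.\<close>

theorem theorem3p1:
  "\<exists>C>0. \<forall>(x::int) (y::int) (m::int) (z::int) (L::real).
     x \<ge> 7 \<longrightarrow> m \<noteq> 0 \<longrightarrow>
     z = max (y\<^sup>2) (int (omega m)) \<longrightarrow>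
     L = ln (ln (real_of_int x) / (real_of_int y * ln (sqrt (real_of_int z)))) \<longrightarrow>
     ln (ln (real_of_int x)) \<le> real_of_int y \<longrightarrow>
     real_of_int y \<le> ln (real_of_int x) / (3 * ln (ln (real_of_int x))) \<longrightarrow>
     y\<^sup>2 \<le> z \<longrightarrow>
     real_of_int z \<le> real_of_int x powr (2 / (3 * real_of_int y)) \<longrightarrow>
     (\<exists>\<theta>::real. \<bar>\<theta>\<bar> \<le> C * (real_of_int y / L) \<and>
        (\<Sum>n | 0 < n \<and> n \<le> x \<and> int (omega n) = y \<and> coprime n m \<and> squarefree n. (1::real))
          \<ge> real_of_int x / ln (real_of_int x) * (L powr (real_of_int y + \<theta>) / fact (nat y)))"
proof -
  obtain C :: real where C: "C > 0"
    and bound: "\<And>x m k z. admissible x m k z \<Longrightarrow>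
       real x / ln (real x)
         * (admissible.L x k z powr (real (Suc k) - C * (real (Suc k) / admissible.L x k z)) / fact (Suc k))
       \<le> real (card (admissible.N x m k))"
    using squarefree_count_lower by blast
  show ?thesis
  proof (rule exI[of _ C], rule conjI[OF C], intro allI impI)
    fix x y m z :: int and L :: real
    assume x: "x \<ge> 7" and m: "m \<noteq> 0" and z: "z = max (y\<^sup>2) (int (omega m))"
      and L: "L = ln (ln (real_of_int x) / (real_of_int y * ln (sqrt (real_of_int z))))"
      and y: "ln (ln (real_of_int x)) \<le> real_of_int y"
        "real_of_int y \<le> ln (real_of_int x) / (3 * ln (ln (real_of_int x)))"
      and z_le: "real_of_int z \<le> real_of_int x powr (2 / (3 * real_of_int y))"
    have "ln 7 \<le> ln (real_of_int x)" using x by simp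
    hence "ln (real_of_int x) > 1" using ln_7_ge by linarith
    hence lnln: "ln (ln (real_of_int x)) > 0" by simp
    hence "y > 0" using y(1) by linarith
    define k where "k = nat y - 1"
    have k: "Suc k = nat y" using \<open>y > 0\<close> by (simp add: k_def)
    have yk: "y = int (Suc k)" using k \<open>y > 0\<close> by simp
    have z0: "z \<ge> 0" using z by (simp add: le_max_iff_disj)
    have reals: "real (nat x) = real_of_int x" "real (Suc k) = real_of_int y" "real (nat z) = real_of_int z"
      using x z0 by (simp_all add: yk)
    interpret P: admissible "nat x" "nat \<bar>m\<bar>" k "nat z"
    proof
      show "(Suc k)\<^sup>2 \<le> nat z" using z unfolding yk by (simp add: le_nat_iff nat_le_iff)
      show "card (prime_factors (nat \<bar>m\<bar>)) \<le> nat z"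
        using z unfolding card_prime_factors_nat_abs[OF m] by simp
      show "real (Suc k) * (3 * ln (ln (real (nat x)))) \<le> ln (real (nat x))"
        unfolding reals using y(2) lnln by (simp add: le_divide_eq)
      show "ln (ln (real (nat x))) \<le> real (Suc k)" unfolding reals by (rule y(1))
      show "real (nat z) \<le> real (nat x) powr (2 / (3 * real (Suc k)))" unfolding reals by (rule z_le)
    qed (use x m in auto)
    have L': "P.L = L" unfolding P.L_def L reals ..
    show "\<exists>\<theta>. \<bar>\<theta>\<bar> \<le> C * (real_of_int y / L) \<and>
        (\<Sum>n | 0 < n \<and> n \<le> x \<and> int (omega n) = y \<and> coprime n m \<and> squarefree n. (1::real))
          \<ge> real_of_int x / ln (real_of_int x) * (L powr (real_of_int y + \<theta>) / fact (nat y))"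
    \<comment> \<open>The most negative admissible \<open>\<theta>\<close> is the witness.\<close>
    proof (intro exI[of _ "- (C * (real_of_int y / L))"] conjI)
      have "real_of_int y / L \<ge> 1" using P.L_bounds(4) unfolding L' reals .
      hence "0 \<le> C * (real_of_int y / L)" using C by (intro mult_nonneg_nonneg) linarith+
      thus "\<bar>- (C * (real_of_int y / L))\<bar> \<le> C * (real_of_int y / L)"
        by (simp only: abs_minus_cancel abs_of_nonneg order.refl)
      have "real_of_int x / ln (real_of_int x)
          * (L powr (real_of_int y + - (C * (real_of_int y / L))) / fact (nat y))
        \<le> real (card P.N)"
        using bound[OF P.admissible_axioms] unfolding L' reals unfolding k diff_conv_add_uminus .
      also have "\<dots> \<le> (\<Sum>n | 0 < n \<and> n \<le> x \<and> int (omega n) = y \<and> coprime n m \<and> squarefree n. 1)"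
        unfolding P.N_def k using m x \<open>y > 0\<close> by (intro card_squarefree_nat_le_sum_int) auto
      finally show "real_of_int x / ln (real_of_int x)
          * (L powr (real_of_int y + - (C * (real_of_int y / L))) / fact (nat y))
        \<le> (\<Sum>n | 0 < n \<and> n \<le> x \<and> int (omega n) = y \<and> coprime n m \<and> squarefree n. 1)" .
    qed
  qed
qed

end
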